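(* Let $e_1,e_2,e_3\in\mathbb{C}$ be pairwise distinct and let $L\subset\mathfrak{R}_{e_1,e_2,e_3}$ be a Lie subalgebra of finite codimension. Then the associative algebra $\mathcal{I}(L)$ is commutative and is isomorphic to the field $Q_{e_1,e_2,e_3}$.
   Context: Work over $\mathbb{C}$. Let $E_{e_1,e_2,e_3}=\mathbb{C}[v_1,v_2,v_3]/I$, where $I$ is the ideal generated by $v_i^2-v_j^2+e_i-e_j$, $i,j=1,2,3$ (an integral domain when the $e_i$ are pairwise distinct), with $\hat v_i$ the image of $v_i$. Let $\alpha_1,\alpha_2,\alpha_3$ be a basis of $\mathfrak{so}_3(\mathbb{C})$ with $[\alpha_1,\alpha_2]=\alpha_3$, $[\alpha_2,\alpha_3]=\alpha_1$, $[\alpha_3,\alpha_1]=\alpha_2$; $\mathfrak{so}_3(\mathbb{C})\otimes E_{e_1,e_2,e_3}$ has bracket $[\alpha\otimes h_1,\beta\otimes h_2]=[\alpha,\beta]\otimes h_1h_2$, and $\mathfrak{R}_{e_1,e_2,e_3}$ is its Lie subalgebra generated by $\alpha_i\otimes\hat v_i$, $i=1,2,3$. Let $z=\hat v_1^2+e_1$ $(=\hat v_2^2+e_2=\hat v_3^2+e_3)$ and $y=\hat v_1\hat v_2\hat v_3$; $Q_{e_1,e_2,e_3}$ is the subfield of the fraction field of $E_{e_1,e_2,e_3}$ generated by $z$ and $y$ (it is isomorphic to the function field of the elliptic curve $y^2=(z-e_1)(z-e_2)(z-e_3)$). For a Lie algebra $\mathfrak{L}$, an admissible pair is $(h,\mathfrak{h})$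 with $\mathfrak{h}\subset\mathfrak{L}$ a Lie subalgebra of finite codimension and $h\colon\mathfrak{h}\to\mathfrak{L}$ linear with $h([p_1,p_2])=[h(p_1),p_2]=[p_1,h(p_2)]$ for all $p_1,p_2\in\mathfrak{h}$. Two admissible pairs $(h,\mathfrak{h}),(\tilde h,\tilde{\mathfrak{h}})$ are equivalent if $h$ and $\tilde h$ agree on some subalgebra of finite codimension contained in $\mathfrak{h}\cap\tilde{\mathfrak{h}}$. $\mathcal{I}(\mathfrak{L})$ is the set of equivalence classes, an associative algebra with $c[(h,\mathfrak{h})]=[(ch,\mathfrak{h})]$, $[(h_1,\mathfrak{h}_1)]+[(h_2,\mathfrak{h}_2)]=[(h_1+h_2,\mathfrak{h}_1\cap\mathfrak{h}_2)]$, and $[(h_1,\mathfrak{h}_1)]\cdot[(h_2,\mathfrak{h}_2)]=[(h_1\circ h_2,\hat{\mathfrak{h}})]$ with $\hat{\mathfrak{h}}=\{w\in\mathfrak{h}_1\cap\mathfrak{h}_2: h_2(w)\in\mathfrak{h}_1\}$. *)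

theory Defs
  imports Complex_Main "HOL-Library.Poly_Mapping" "HOL-Library.Product_Plus"
begin

text \<open>Polynomials in three variables: finitely supported maps from exponent
  triples (a,b,c) (monomial v1^a v2^b v3^c) to coefficients.\<close>
type_synonym mpoly3 = "(nat \<times> nat \<times> nat) \<Rightarrow>\<^sub>0 complex"

definition mvar :: "nat \<Rightarrow> mpoly3" where
  "mvar i = Poly_Mapping.single
      (if i = 1 then (1,0,0) else if i = 2 then (0,1,0) else (0,0,1)) 1"

definition mconst :: "complex \<Rightarrow> mpoly3" where
  "mconst c = Poly_Mapping.single (0,0,0) c"

definition epar :: "complex \<Rightarrow> complex \<Rightarrow> complex \<Rightarrow> nat \<Rightarrow> complex" where
  "epar e1 e2 e3 i = (if i = 1 then e1 else if i = 2 then e2 else e3)"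

inductive_set ideal_gen :: "mpoly3 set \<Rightarrow> mpoly3 set" for G where
  ig_zero: "0 \<in> ideal_gen G"
| ig_gen: "g \<in> G \<Longrightarrow> g \<in> ideal_gen G"
| ig_add: "a \<in> ideal_gen G \<Longrightarrow> b \<in> ideal_gen G \<Longrightarrow> a + b \<in> ideal_gen G"
| ig_mult: "a \<in> ideal_gen G \<Longrightarrow> r * a \<in> ideal_gen G"

definition Igens :: "complex \<Rightarrow> complex \<Rightarrow> complex \<Rightarrow> mpoly3 set" where
  "Igens e1 e2 e3 = {mvar i ^ 2 - mvar j ^ 2 + mconst (epar e1 e2 e3 i - epar e1 e2 e3 j)
                     | i j. i \<in> {1,2,3} \<and> j \<in> {1,2,3}}"

definition Iideal :: "complex \<Rightarrow> complex \<Rightarrow> complex \<Rightarrow> mpoly3 set" where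
  "Iideal e1 e2 e3 = ideal_gen (Igens e1 e2 e3)"

text \<open>Elements of E are cosets p + I.\<close>
type_synonym Eel = "mpoly3 set"

definition Ecl :: "complex \<Rightarrow> complex \<Rightarrow> complex \<Rightarrow> mpoly3 \<Rightarrow> Eel" where
  "Ecl e1 e2 e3 p = {q. q - p \<in> Iideal e1 e2 e3}"

definition Eset :: "complex \<Rightarrow> complex \<Rightarrow> complex \<Rightarrow> Eel set" where
  "Eset e1 e2 e3 = range (Ecl e1 e2 e3)"

definition Eop2 :: "complex \<Rightarrow> complex \<Rightarrow> complex \<Rightarrow> (mpoly3 \<Rightarrow> mpoly3 \<Rightarrow> mpoly3)
                     \<Rightarrow> Eel \<Rightarrow> Eel \<Rightarrow> Eel" where
  "Eop2 e1 e2 e3 f A B = (\<Union>a\<in>A. \<Union>b\<in>B. Ecl e1 e2 e3 (f a b))"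

definition Eadd where "Eadd e1 e2 e3 = Eop2 e1 e2 e3 (+)"
definition Esub where "Esub e1 e2 e3 = Eop2 e1 e2 e3 (-)"
definition Emul where "Emul e1 e2 e3 = Eop2 e1 e2 e3 (*)"
definition Escale :: "complex \<Rightarrow> complex \<Rightarrow> complex \<Rightarrow> complex \<Rightarrow> Eel \<Rightarrow> Eel" where
  "Escale e1 e2 e3 c A = (\<Union>a\<in>A. Ecl e1 e2 e3 (mconst c * a))"

definition Ehat :: "complex \<Rightarrow> complex \<Rightarrow> complex \<Rightarrow> nat \<Rightarrow> Eel" where
  "Ehat e1 e2 e3 i = Ecl e1 e2 e3 (mvar i)"

text \<open>An element a1 \<otimes> h1 + a2 \<otimes> h2 + a3 \<otimes> h3 (basis alpha_i) is the triple (h1,h2,h3).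
  With [a1,a2]=a3, [a2,a3]=a1, [a3,a1]=a2 the bracket is the cross product.\<close>
type_synonym tens = "Eel \<times> Eel \<times> Eel"

definition tzero :: "complex \<Rightarrow> complex \<Rightarrow> complex \<Rightarrow> tens" where
  "tzero e1 e2 e3 = (Ecl e1 e2 e3 0, Ecl e1 e2 e3 0, Ecl e1 e2 e3 0)"

definition tadd :: "complex \<Rightarrow> complex \<Rightarrow> complex \<Rightarrow> tens \<Rightarrow> tens \<Rightarrow> tens" where
  "tadd e1 e2 e3 x y = (case x of (a1,a2,a3) \<Rightarrow> case y of (b1,b2,b3) \<Rightarrow>
     (Eadd e1 e2 e3 a1 b1, Eadd e1 e2 e3 a2 b2, Eadd e1 e2 e3 a3 b3))"

definition tsmul :: "complex \<Rightarrow> complex \<Rightarrow> complex \<Rightarrow> complex \<Rightarrow> tens \<Rightarrow> tens" where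
  "tsmul e1 e2 e3 c x = (case x of (a1,a2,a3) \<Rightarrow>
     (Escale e1 e2 e3 c a1, Escale e1 e2 e3 c a2, Escale e1 e2 e3 c a3))"

definition tbr :: "complex \<Rightarrow> complex \<Rightarrow> complex \<Rightarrow> tens \<Rightarrow> tens \<Rightarrow> tens" where
  "tbr e1 e2 e3 x y = (case x of (a1,a2,a3) \<Rightarrow> case y of (b1,b2,b3) \<Rightarrow>
     (Esub e1 e2 e3 (Emul e1 e2 e3 a2 b3) (Emul e1 e2 e3 a3 b2),
      Esub e1 e2 e3 (Emul e1 e2 e3 a3 b1) (Emul e1 e2 e3 a1 b3),
      Esub e1 e2 e3 (Emul e1 e2 e3 a1 b2) (Emul e1 e2 e3 a2 b1)))"

inductive_set Rgen :: "complex \<Rightarrow> complex \<Rightarrow> complex \<Rightarrow> tens set" for e1 e2 e3 where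
  R_zero: "tzero e1 e2 e3 \<in> Rgen e1 e2 e3"
| R_gen1: "(Ehat e1 e2 e3 1, Ecl e1 e2 e3 0, Ecl e1 e2 e3 0) \<in> Rgen e1 e2 e3"
| R_gen2: "(Ecl e1 e2 e3 0, Ehat e1 e2 e3 2, Ecl e1 e2 e3 0) \<in> Rgen e1 e2 e3"
| R_gen3: "(Ecl e1 e2 e3 0, Ecl e1 e2 e3 0, Ehat e1 e2 e3 3) \<in> Rgen e1 e2 e3"
| R_add: "x \<in> Rgen e1 e2 e3 \<Longrightarrow> y \<in> Rgen e1 e2 e3 \<Longrightarrow> tadd e1 e2 e3 x y \<in> Rgen e1 e2 e3"
| R_smul: "x \<in> Rgen e1 e2 e3 \<Longrightarrow> tsmul e1 e2 e3 c x \<in> Rgen e1 e2 e3"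
| R_br: "x \<in> Rgen e1 e2 e3 \<Longrightarrow> y \<in> Rgen e1 e2 e3 \<Longrightarrow> tbr e1 e2 e3 x y \<in> Rgen e1 e2 e3"

record 'v lie_alg =
  lcarrier :: "'v set"
  ladd :: "'v \<Rightarrow> 'v \<Rightarrow> 'v"
  lsmul :: "complex \<Rightarrow> 'v \<Rightarrow> 'v"
  lbr :: "'v \<Rightarrow> 'v \<Rightarrow> 'v"
  lzero :: 'v

definition Rlie :: "complex \<Rightarrow> complex \<Rightarrow> complex \<Rightarrow> tens lie_alg" where
  "Rlie e1 e2 e3 = \<lparr>lcarrier = Rgen e1 e2 e3, ladd = tadd e1 e2 e3, lsmul = tsmul e1 e2 e3,
                    lbr = tbr e1 e2 e3, lzero = tzero e1 e2 e3\<rparr>"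

definition lie_subalg :: "'v lie_alg \<Rightarrow> 'v set \<Rightarrow> bool" where
  "lie_subalg M S \<longleftrightarrow> S \<subseteq> lcarrier M \<and> lzero M \<in> S
     \<and> (\<forall>x\<in>S. \<forall>y\<in>S. ladd M x y \<in> S)
     \<and> (\<forall>c. \<forall>x\<in>S. lsmul M c x \<in> S)
     \<and> (\<forall>x\<in>S. \<forall>y\<in>S. lbr M x y \<in> S)"

inductive_set lin_hull :: "'v lie_alg \<Rightarrow> 'v set \<Rightarrow> 'v set" for M X where
  lh_zero: "lzero M \<in> lin_hull M X"
| lh_base: "x \<in> X \<Longrightarrow> x \<in> lin_hull M X"
| lh_add: "x \<in> lin_hull M X \<Longrightarrow> y \<in> lin_hull M X \<Longrightarrow> ladd M x y \<in> lin_hull M X"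
| lh_smul: "x \<in> lin_hull M X \<Longrightarrow> lsmul M c x \<in> lin_hull M X"

definition fin_codim :: "'v lie_alg \<Rightarrow> 'v set \<Rightarrow> bool" where
  "fin_codim M S \<longleftrightarrow> (\<exists>F. finite F \<and> F \<subseteq> lcarrier M \<and> lcarrier M \<subseteq> lin_hull M (S \<union> F))"

definition admissible :: "'v lie_alg \<Rightarrow> ('v \<Rightarrow> 'v) \<times> 'v set \<Rightarrow> bool" where
  "admissible M P \<longleftrightarrow> (case P of (h, H) \<Rightarrow>
     lie_subalg M H \<and> fin_codim M H \<and> (\<forall>p\<in>H. h p \<in> lcarrier M)
     \<and> (\<forall>p\<in>H. \<forall>q\<in>H. h (ladd M p q) = ladd M (h p) (h q))
     \<and> (\<forall>c. \<forall>p\<in>H. h (lsmul M c p) = lsmul M c (h p))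
     \<and> (\<forall>p1\<in>H. \<forall>p2\<in>H. h (lbr M p1 p2) = lbr M (h p1) p2
                       \<and> h (lbr M p1 p2) = lbr M p1 (h p2)))"

definition adm_equiv :: "'v lie_alg \<Rightarrow> ('v \<Rightarrow> 'v) \<times> 'v set \<Rightarrow> ('v \<Rightarrow> 'v) \<times> 'v set \<Rightarrow> bool" where
  "adm_equiv M P Q \<longleftrightarrow> (case P of (h, H) \<Rightarrow> case Q of (h', H') \<Rightarrow>
     (\<exists>K. lie_subalg M K \<and> fin_codim M K \<and> K \<subseteq> H \<inter> H' \<and> (\<forall>x\<in>K. h x = h' x)))"

definition adm_class :: "'v lie_alg \<Rightarrow> ('v \<Rightarrow> 'v) \<times> 'v set \<Rightarrow> (('v \<Rightarrow> 'v) \<times> 'v set) set" where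
  "adm_class M P = {Q. admissible M Q \<and> adm_equiv M P Q}"

definition Icarrier :: "'v lie_alg \<Rightarrow> (('v \<Rightarrow> 'v) \<times> 'v set) set set" where
  "Icarrier M = {adm_class M P | P. admissible M P}"

definition I_add :: "'v lie_alg \<Rightarrow> (('v \<Rightarrow> 'v) \<times> 'v set) set
                     \<Rightarrow> (('v \<Rightarrow> 'v) \<times> 'v set) set \<Rightarrow> (('v \<Rightarrow> 'v) \<times> 'v set) set" where
  "I_add M A B = (\<Union>(h1, H1)\<in>A. \<Union>(h2, H2)\<in>B.
                    adm_class M (\<lambda>x. ladd M (h1 x) (h2 x), H1 \<inter> H2))"

definition I_smul :: "'v lie_alg \<Rightarrow> complex \<Rightarrow> (('v \<Rightarrow> 'v) \<times> 'v set) set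
                     \<Rightarrow> (('v \<Rightarrow> 'v) \<times> 'v set) set" where
  "I_smul M c A = (\<Union>(h, H)\<in>A. adm_class M (\<lambda>x. lsmul M c (h x), H))"

definition I_mul :: "'v lie_alg \<Rightarrow> (('v \<Rightarrow> 'v) \<times> 'v set) set
                     \<Rightarrow> (('v \<Rightarrow> 'v) \<times> 'v set) set \<Rightarrow> (('v \<Rightarrow> 'v) \<times> 'v set) set" where
  "I_mul M A B = (\<Union>(h1, H1)\<in>A. \<Union>(h2, H2)\<in>B.
                    adm_class M (h1 \<circ> h2, {w \<in> H1 \<inter> H2. h2 w \<in> H1}))"

definition zel :: "complex \<Rightarrow> complex \<Rightarrow> complex \<Rightarrow> Eel" where
  "zel e1 e2 e3 = Ecl e1 e2 e3 (mvar 1 ^ 2 + mconst e1)"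

definition yel :: "complex \<Rightarrow> complex \<Rightarrow> complex \<Rightarrow> Eel" where
  "yel e1 e2 e3 = Ecl e1 e2 e3 (mvar 1 * mvar 2 * mvar 3)"

definition frac_pairs :: "complex \<Rightarrow> complex \<Rightarrow> complex \<Rightarrow> (Eel \<times> Eel) set" where
  "frac_pairs e1 e2 e3 = {(a, b). a \<in> Eset e1 e2 e3 \<and> b \<in> Eset e1 e2 e3 \<and> b \<noteq> Ecl e1 e2 e3 0}"

definition frac_class :: "complex \<Rightarrow> complex \<Rightarrow> complex \<Rightarrow> Eel \<times> Eel \<Rightarrow> (Eel \<times> Eel) set" where
  "frac_class e1 e2 e3 p = {(c, d) \<in> frac_pairs e1 e2 e3.
      Emul e1 e2 e3 (fst p) d = Emul e1 e2 e3 (snd p) c}"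

inductive_set Qreps :: "complex \<Rightarrow> complex \<Rightarrow> complex \<Rightarrow> (Eel \<times> Eel) set" for e1 e2 e3 where
  Q_const: "(Ecl e1 e2 e3 (mconst c), Ecl e1 e2 e3 1) \<in> Qreps e1 e2 e3"
| Q_z: "(zel e1 e2 e3, Ecl e1 e2 e3 1) \<in> Qreps e1 e2 e3"
| Q_y: "(yel e1 e2 e3, Ecl e1 e2 e3 1) \<in> Qreps e1 e2 e3"
| Q_add: "(a, b) \<in> Qreps e1 e2 e3 \<Longrightarrow> (c, d) \<in> Qreps e1 e2 e3 \<Longrightarrow>
     (Eadd e1 e2 e3 (Emul e1 e2 e3 a d) (Emul e1 e2 e3 b c), Emul e1 e2 e3 b d) \<in> Qreps e1 e2 e3"
| Q_mul: "(a, b) \<in> Qreps e1 e2 e3 \<Longrightarrow> (c, d) \<in> Qreps e1 e2 e3 \<Longrightarrow>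
     (Emul e1 e2 e3 a c, Emul e1 e2 e3 b d) \<in> Qreps e1 e2 e3"
| Q_neg: "(a, b) \<in> Qreps e1 e2 e3 \<Longrightarrow> (Esub e1 e2 e3 (Ecl e1 e2 e3 0) a, b) \<in> Qreps e1 e2 e3"
| Q_inv: "(a, b) \<in> Qreps e1 e2 e3 \<Longrightarrow> a \<noteq> Ecl e1 e2 e3 0 \<Longrightarrow> (b, a) \<in> Qreps e1 e2 e3"

definition Qcarrier :: "complex \<Rightarrow> complex \<Rightarrow> complex \<Rightarrow> (Eel \<times> Eel) set set" where
  "Qcarrier e1 e2 e3 = frac_class e1 e2 e3 ` Qreps e1 e2 e3"

definition Q_add :: "complex \<Rightarrow> complex \<Rightarrow> complex \<Rightarrow> (Eel \<times> Eel) set \<Rightarrow> (Eel \<times> Eel) set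
                     \<Rightarrow> (Eel \<times> Eel) set" where
  "Q_add e1 e2 e3 X Y = (\<Union>(a, b)\<in>X. \<Union>(c, d)\<in>Y. frac_class e1 e2 e3
      (Eadd e1 e2 e3 (Emul e1 e2 e3 a d) (Emul e1 e2 e3 b c), Emul e1 e2 e3 b d))"

definition Q_mul :: "complex \<Rightarrow> complex \<Rightarrow> complex \<Rightarrow> (Eel \<times> Eel) set \<Rightarrow> (Eel \<times> Eel) set
                     \<Rightarrow> (Eel \<times> Eel) set" where
  "Q_mul e1 e2 e3 X Y = (\<Union>(a, b)\<in>X. \<Union>(c, d)\<in>Y. frac_class e1 e2 e3
      (Emul e1 e2 e3 a c, Emul e1 e2 e3 b d))"

definition Q_smul :: "complex \<Rightarrow> complex \<Rightarrow> complex \<Rightarrow> complex \<Rightarrow> (Eel \<times> Eel) set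
                     \<Rightarrow> (Eel \<times> Eel) set" where
  "Q_smul e1 e2 e3 c X = (\<Union>(a, b)\<in>X. frac_class e1 e2 e3 (Escale e1 e2 e3 c a, b))"

end

theory Submission
  imports Defs "HOL-Computational_Algebra.Computational_Algebra"
begin

text \<open>
  The coordinate ring E is embedded into the field of Laurent series in X = v1, with v2 and v3
  the square roots of X^2 + e1 - e2 and X^2 + e1 - e3. The kernel is the ideal I because
  1, v2, v3, v2 v3 are linearly independent over the rational functions in X, the polynomials
  under the roots having distinct simple roots.

  Inside triples of Laurent series the Lie algebra is M1 x M2 x M3, where Mi = vi C[z] + vj vk C[z]
  is a module over C[z, y]. Since R/(z - c)R is finite-dimensional and every element of Q has the
  form (g(z) + h(z) y)/f(z), every q in Q maps a subspace of finite codimension of R into R, hence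
  (intersecting) gives an admissible pair on L.

  Conversely, for an admissible pair [h p, p] = 0 forces h p to be proportional to p, and
  [h p, s] = [p, h s] forces the factor q to be the same for all p. Comparing coordinates,
  q = (vi n)/(vi m) with m, n in Mi, and vi Mi lies in C[z, y], so q lies in Q. Thus equivalence
  classes of admissible pairs correspond to elements of Q.
\<close>

section \<open>Subspaces of finite codimension\<close>

text \<open>The definitions give E as a set of cosets, Q as a set of classes of pairs of cosets and
  the algebra attached to L as a set of classes of partial maps, with operations that are unions
  over representatives. Laurent series supply one field in which all of this can be computed: a
  coset becomes a series, a fraction a quotient of series, and a class of admissible pairs the
  factor q. The maps \<open>fib\<close>, \<open>tau\<close>, \<open>fracs_of\<close> and
  \<open>pairs_acting_by\<close> lead back; each is injective on the relevant set, and each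
  operation takes the same value on all representatives. Besides making roots simple, the hypotheses
  on the e_i enter in two ways: e1 - e2 and e1 - e3 are nonzero constant terms of the radicands, so
  the roots exist as power series, and e2 differs from e3, so the radicands share no root. The
  factor q obtained from an admissible pair is at first an arbitrary Laurent series. To compare the
  factors of different vectors, the domain must contain two vectors that are not parallel, although
  only its codimension is controlled; here the infinite dimension of C[z] d for nonzero d is
  decisive.\<close>

locale finite_codimension = vs: vector_space scale
  for scale :: "'a::field \<Rightarrow> 'b::ab_group_add \<Rightarrow> 'b"
begin

text \<open>Finitely many extra generators stand for a finite-dimensional quotient, as in
  \<open>fin_codim\<close>, so the two notions translate into each other without quotient
  spaces.\<close>

definition fincodim :: "'b set \<Rightarrow> 'b set \<Rightarrow> bool" where
  "fincodim S W \<longleftrightarrow> (\<exists>G. finite G \<and> G \<subseteq> W \<and> W \<subseteq> vs.span (S \<union> G))"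

lemma fincodim_refl: "fincodim W W"
  unfolding fincodim_def by (rule exI[of _ "{}"]) (auto intro: vs.span_base)

lemma fincodim_mono: "fincodim S W \<Longrightarrow> S \<subseteq> S' \<Longrightarrow> fincodim S' W"
  unfolding fincodim_def by (meson Un_mono order_refl order_trans vs.span_mono)

lemma fincodim_trans:
  assumes "fincodim K S" "fincodim S W" "S \<subseteq> W"
  shows "fincodim K W"
proof -
  obtain G G' where G: "finite G" "G \<subseteq> S" "S \<subseteq> vs.span (K \<union> G)"
    and G': "finite G'" "G' \<subseteq> W" "W \<subseteq> vs.span (S \<union> G')"
    using assms unfolding fincodim_def by blast
  have "vs.span (K \<union> G) \<subseteq> vs.span (K \<union> (G \<union> G'))" by (rule vs.span_mono) auto
  moreover have "G' \<subseteq> vs.span (K \<union> (G \<union> G'))" by (auto intro: vs.span_base)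
  ultimately have "S \<union> G' \<subseteq> vs.span (K \<union> (G \<union> G'))" using G(3) by blast
  then have "vs.span (S \<union> G') \<subseteq> vs.span (K \<union> (G \<union> G'))" by (simp add: vs.span_minimal)
  then show ?thesis using G G' assms(3) unfolding fincodim_def
    by (intro exI[of _ "G \<union> G'"]) auto
qed

text \<open>The map induced by \<open>g\<close> embeds the quotient of \<open>S\<close> by the
  preimage into the quotient of \<open>W\<close> by \<open>N\<close>. With the identity for
  \<open>g\<close> this handles intersections, with multiplication by a series the domains of
  composites and restrictions.\<close>

lemma fincodim_vimage:
  assumes "fincodim N W" "vs.subspace S" "vs.subspace N" "g ` S \<subseteq> W"
    and add: "\<And>x y. x \<in> S \<Longrightarrow> y \<in> S \<Longrightarrow> g (x + y) = g x + g y"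
    and scale: "\<And>c x. x \<in> S \<Longrightarrow> g (scale c x) = scale c (g x)"
  shows "fincodim {s \<in> S. g s \<in> N} S"
proof -
  \<comment> \<open>\<open>W\<close> disappears and \<open>N\<close> varies: the induction moves one
    generator after another from \<open>G\<close> into \<open>N\<close>, and each move enlarges the
    preimage by at most one dimension.\<close>
  have *: "finite G \<Longrightarrow> vs.subspace N \<Longrightarrow> g ` S \<subseteq> vs.span (N \<union> G) \<Longrightarrow> fincodim {s \<in> S. g s \<in> N} S" for G
  proof (induction G arbitrary: N rule: finite_induct)
    case empty
    then have "vs.span N = N" by (simp add: vs.span_eq_iff)
    with empty have "{s \<in> S. g s \<in> N} = S" by auto
    then show ?case by (simp add: fincodim_refl)
  next
    case (insert x G)
    define N' where "N' = vs.span (insert x N)"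
    have "insert x N \<subseteq> N'" unfolding N'_def by (rule vs.span_superset)
    then have "N \<union> insert x G \<subseteq> vs.span (N' \<union> G)"
      using vs.span_superset[of "N' \<union> G"] by blast
    then have "g ` S \<subseteq> vs.span (N' \<union> G)"
      using insert.prems(2) by (meson order_trans vs.span_minimal vs.subspace_span)
    then have IH: "fincodim {s \<in> S. g s \<in> N'} S"
      using insert.IH[of N'] unfolding N'_def by simp
    have span_N: "vs.span N = N" using insert.prems(1) by simp
    then have N'E: "\<exists>k. y - scale k x \<in> N" if "y \<in> N'" for y
      using that unfolding N'_def vs.span_insert span_N by simp
    show ?case
    proof (cases "{s \<in> S. g s \<in> N'} \<subseteq> {s \<in> S. g s \<in> N}")
      case True
      then show ?thesis using IH fincodim_mono by blast
    next
      case False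
      then obtain s0 where s0: "s0 \<in> S" "g s0 \<in> N'" "g s0 \<notin> N" by blast
      obtain k0 where k0: "g s0 - scale k0 x \<in> N" using N'E s0 by blast
      have k0n: "k0 \<noteq> 0" using k0 s0 by auto
      have "s \<in> vs.span ({s \<in> S. g s \<in> N} \<union> {s0})" if s: "s \<in> S" "g s \<in> N'" for s
      proof -
        obtain k where k: "g s - scale k x \<in> N" using N'E s by blast
        \<comment> \<open>The multiple of \<open>s0\<close> cancels the \<open>x\<close>-component
          of \<open>g s\<close> modulo \<open>N\<close>, so \<open>t\<close> lies in the preimage of
          \<open>N\<close>.\<close>
        define t where "t = s + scale (- (k / k0)) s0"
        have tS: "t \<in> S"
          unfolding t_def using s s0 assms(2) by (intro vs.subspace_add vs.subspace_scale)
        have "g t = g s + scale (- (k / k0)) (g s0)"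
          unfolding t_def scale[OF s0(1), symmetric]
          by (intro add s(1) s0(1) vs.subspace_scale[OF assms(2)])
        also have "\<dots> = (g s - scale k x) + scale (- (k / k0)) (g s0 - scale k0 x)"
          using k0n by (simp add: vs.scale_right_diff_distrib)
        also have "\<dots> \<in> N"
          using insert.prems(1) k k0 by (intro vs.subspace_add vs.subspace_scale)
        finally have "t \<in> vs.span ({s \<in> S. g s \<in> N} \<union> {s0})" using tS by (auto intro: vs.span_base)
        moreover have "scale (k / k0) s0 \<in> vs.span ({s \<in> S. g s \<in> N} \<union> {s0})"
          by (intro vs.span_scale vs.span_base) auto
        ultimately have "t + scale (k / k0) s0 \<in> vs.span ({s \<in> S. g s \<in> N} \<union> {s0})"
          by (rule vs.span_add)
        then show ?thesis unfolding t_def by (simp add: vs.scale_minus_left)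
      qed
      then have "fincodim {s \<in> S. g s \<in> N} {s \<in> S. g s \<in> N'}"
        unfolding fincodim_def using s0 by (intro exI[of _ "{s0}"]) auto
      then show ?thesis using IH fincodim_trans by blast
    qed
  qed
  obtain G where "finite G" "W \<subseteq> vs.span (N \<union> G)"
    using assms(1) unfolding fincodim_def by auto
  then show ?thesis using * assms(3,4) by (meson order_trans)
qed

lemma fincodim_Int:
  assumes "fincodim N W" "vs.subspace S" "vs.subspace N" "S \<subseteq> W"
  shows "fincodim (S \<inter> N) S"
proof -
  have "{s \<in> S. s \<in> N} = S \<inter> N" by auto
  then show ?thesis using fincodim_vimage[OF assms(1-3), of "\<lambda>x. x"] assms(4) by simp
qed

end

section \<open>Evaluation of polynomials through a ring homomorphism\<close>

text \<open>Polynomials in one variable are evaluated both in the polynomial ring in v1, v2, v3 and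
  in Laurent series; the embedding \<open>c\<close> of the constants is a parameter so that one set
  of rules serves both.\<close>

locale const_hom =
  fixes c :: "complex \<Rightarrow> 'a::comm_ring_1"
  assumes c0 [simp]: "c 0 = 0" and c1 [simp]: "c 1 = 1"
    and c_add: "c (a + b) = c a + c b" and c_mult: "c (a * b) = c a * c b"
begin

definition pev :: "'a \<Rightarrow> complex poly \<Rightarrow> 'a" where
  "pev x f = poly (map_poly c f) x"

lemma pev_0 [simp]: "pev x 0 = 0" by (simp add: pev_def)
lemma pev_1 [simp]: "pev x 1 = 1" by (simp add: pev_def)

lemma pev_pCons [simp]: "pev x (pCons a f) = c a + x * pev x f"
  by (simp add: pev_def map_poly_pCons)

lemma pev_add: "pev x (f + g) = pev x f + pev x g"
proof (induction f arbitrary: g)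
  case (pCons a f)
  obtain b h where "g = pCons b h" by (cases g)
  then show ?case using pCons.IH[of h] by (simp add: c_add algebra_simps)
qed simp

lemma pev_2 [simp]: "pev x 2 = 2"
  using pev_add[of x 1 1] by simp

lemma pev_smult: "pev x (smult a g) = c a * pev x g"
  by (induction g) (simp_all add: c_mult algebra_simps)

lemma pev_mult: "pev x (f * g) = pev x f * pev x g"
  by (induction f) (simp_all add: pev_add pev_smult algebra_simps)

lemma pev_power: "pev x (f ^ n) = pev x f ^ n"
  by (induction n) (simp_all add: pev_mult)

lemma c_uminus: "c (- a) = - c a"
proof -
  have "c (- a) + c a = 0" by (simp add: c_add[symmetric])
  then show ?thesis by (simp add: eq_neg_iff_add_eq_0)
qed

lemma c_diff: "c (a - b) = c a - c b"
  using c_add[of a "- b"] by (simp add: c_uminus)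

lemma pev_uminus: "pev x (- f) = - pev x f"
  by (induction f) (simp_all add: c_uminus)

lemma pev_diff: "pev x (f - g) = pev x f - pev x g"
  using pev_add[of x f "- g"] by (simp add: pev_uminus)

end

interpretation fls: const_hom "fls_const :: complex \<Rightarrow> complex fls"
  by standard (simp_all add: fls_plus_const)

interpretation mp: const_hom mconst
  by standard (simp_all add: mconst_def single_add mult_single zero_prod_def[symmetric])

text \<open>Evaluation at X is the inclusion of polynomials into series, hence injective: X is
  transcendental over the constants.\<close>

lemma pev_fls_X: "fls.pev fls_X f = fps_to_fls (fps_of_poly f)"
  by (induction f) (simp_all add: fps_of_poly_pCons fls_times_fps_to_fls algebra_simps)

lemma pev_fls_X_eq_0_iff [simp]: "fls.pev fls_X f = 0 \<longleftrightarrow> f = 0"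
  using fps_of_poly_eq_iff[of f 0] by (simp add: pev_fls_X)

section \<open>The coordinate ring as a ring of Laurent series\<close>

text \<open>Comparison of orders at \<open>r\<close>: nonzero squares have even order, whereas the
  factor \<open>p\<close> contributes exactly 1 on the right-hand side.\<close>

lemma square_eq_simple_root_mult_square:
  fixes f g p :: "complex poly"
  assumes "f ^ 2 = p * g ^ 2" "order r p = 1" "p \<noteq> 0"
  shows "f = 0 \<and> g = 0"
proof -
  have "g = 0"
  proof (rule ccontr)
    assume g: "g \<noteq> 0"
    with assms have f: "f \<noteq> 0" by auto
    have "order r (f ^ 2) = order r (p * g ^ 2)" by (simp add: assms(1))
    then have "2 * order r f = 1 + 2 * order r g"
      using f g assms(2,3) by (simp add: power2_eq_square order_mult)
    then show False by presburger
  qed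
  then show ?thesis using assms(1) by simp
qed

text \<open>The roots are \<open>r\<close> and \<open>-r\<close>, and they differ because
  \<open>a\<close> is nonzero.\<close>

lemma order_square_minus_const:
  fixes a :: complex
  assumes "r ^ 2 + a = 0" "a \<noteq> 0"
  shows "order r [:a, 0, 1:] = 1"
proof -
  have r: "r \<noteq> 0" using assms by auto
  have "[:a, 0, 1:] = [:-r, 1:] * [:r, 1:]"
  proof -
    have "a = - (r * r)" using assms(1) by (simp add: power2_eq_square eq_neg_iff_add_eq_0 add.commute)
    then show ?thesis by simp
  qed
  moreover have "order r [:-r, 1:] = 1" using order_power_n_n[of r 1] by simp
  moreover have "order r [:r, 1:] = 0" using r by (intro order_0I) simp
  moreover have "[:-r, 1:] * [:r, 1:] \<noteq> 0" by (simp add: no_zero_divisors)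
  ultimately show ?thesis using order_mult[of "[:-r, 1:]" "[:r, 1:]" r] by simp
qed

lemma mpoly3_induct [case_names single add]:
  fixes p :: mpoly3
  assumes "\<And>m k. P (Poly_Mapping.single m k)" "\<And>p q. P p \<Longrightarrow> P q \<Longrightarrow> P (p + q)"
  shows "P p"
proof -
  have *: "P (\<Sum>m\<in>A. Poly_Mapping.single m (Poly_Mapping.lookup p m))" if "finite A" for A
    using that
  proof induction
    case empty
    show ?case using assms(1)[of 0 0] by simp
  qed (simp add: assms)
  have "p = (\<Sum>m\<in>Poly_Mapping.keys p. Poly_Mapping.single m (Poly_Mapping.lookup p m))"
    by (rule poly_mapping_eqI) (auto simp: lookup_sum lookup_single when_def in_keys_iff)
  then show ?thesis using *[of "Poly_Mapping.keys p"] by simp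
qed

lemma single_eq_mvar_power:
  "Poly_Mapping.single (a, b, d) k = mconst k * mvar 1 ^ a * mvar 2 ^ b * mvar 3 ^ d"
proof -
  have s: "Poly_Mapping.single m (1::complex) ^ n = Poly_Mapping.single ((\<Sum>i<n. m)) 1" for m :: "nat \<times> nat \<times> nat" and n
    by (induction n) (simp_all add: mult_single add.commute)
  have "(\<Sum>i<n. (Suc 0,0::nat,0::nat)) = (n,0,0)" "(\<Sum>i<n. (0::nat,Suc 0,0::nat)) = (0,n,0)" "(\<Sum>i<n. (0::nat,0::nat,Suc 0)) = (0,0,n)" for n :: nat
    by (induction n) (simp_all add: zero_prod_def)
  then show ?thesis by (simp add: mvar_def mconst_def s mult_single)
qed

text \<open>X plays the role of v1, and the two equations are then the relations tying v2 and v3 to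
  v1. The roots are parameters here; their existence is supplied in the final proof.\<close>

locale curve_series =
  fixes e1 e2 e3 :: complex and v2 v3 :: "complex fls"
  assumes ne: "e1 \<noteq> e2" "e1 \<noteq> e3" "e2 \<noteq> e3"
    and v2_sq: "v2 ^ 2 = fls_X ^ 2 + fls_const (e1 - e2)"
    and v3_sq: "v3 ^ 2 = fls_X ^ 2 + fls_const (e1 - e3)"
begin

abbreviation "px \<equiv> fls.pev fls_X"

lemma independent_1_v2_v3:
  assumes "px f0 + px f1 * v2 + px f2 * v3 + px f3 * v2 * v3 = 0"
  shows "f0 = 0 \<and> f1 = 0 \<and> f2 = 0 \<and> f3 = 0"
proof -
  define A B where "A = [:e1 - e2, 0, 1:]" and "B = [:e1 - e3, 0, 1:]"
  obtain r s where r: "r ^ 2 + (e1 - e2) = 0" and s: "s ^ 2 + (e1 - e3) = 0"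
    by (metis add.commute add_eq_0_iff power2_csqrt)
  have A1: "order r A = 1" and B1: "order s B = 1"
    unfolding A_def B_def using ne by (intro order_square_minus_const r s, simp)+
  \<comment> \<open>Since \<open>r\<close> is not a root of \<open>B\<close>, it is a simple root of
    \<open>A * B\<close> as well as of \<open>A\<close>; neither can then be a square in
    C(X).\<close>
  have "poly B r \<noteq> 0"
  proof
    assume "poly B r = 0"
    then have "r ^ 2 + (e1 - e3) = 0" by (simp add: B_def power2_eq_square add.commute)
    with r have "e2 = e3" by algebra
    with ne show False by simp
  qed
  then have "order r B = 0" by (rule order_0I)
  have nz [simp]: "A \<noteq> 0" "B \<noteq> 0" by (auto simp: A_def B_def)
  have AB1: "order r (A * B) = 1"
    using A1 \<open>order r B = 0\<close> by (subst order_mult) (simp_all del: One_nat_def)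
  have vA: "v2 ^ 2 = px A" and vB: "v3 ^ 2 = px B"
    unfolding v2_sq v3_sq by (simp_all add: A_def B_def power2_eq_square algebra_simps)
  have no_v2: "f = 0 \<and> g = 0" if "px f + px g * v2 = 0" for f g
  proof -
    have "px f = - (px g * v2)" using that by (simp add: eq_neg_iff_add_eq_0)
    then have "(px f) ^ 2 = (px g) ^ 2 * v2 ^ 2" by (simp add: power_mult_distrib)
    then have "px (f ^ 2 - A * g ^ 2) = 0"
      unfolding vA by (simp add: fls.pev_diff fls.pev_mult power2_eq_square algebra_simps)
    then have "f ^ 2 = A * g ^ 2" by simp
    then show ?thesis using square_eq_simple_root_mult_square A1 \<open>A \<noteq> 0\<close> by blast
  qed
  \<comment> \<open>Squaring the relation between the two sides below and comparing norms over C(X) leaves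
    two sign cases, each of which makes B or A B a square.\<close>
  have "px f0 + px f1 * v2 = - ((px f2 + px f3 * v2) * v3)"
    using assms by (simp add: eq_neg_iff_add_eq_0 algebra_simps)
  then have "(px f0 + px f1 * v2) ^ 2 = (px f2 + px f3 * v2) ^ 2 * v3 ^ 2"
    by (simp add: power_mult_distrib)
  then have "px f0 ^ 2 + px f1 ^ 2 * v2 ^ 2 + 2 * px f0 * px f1 * v2
      = (px f2 ^ 2 + px f3 ^ 2 * v2 ^ 2 + 2 * px f2 * px f3 * v2) * v3 ^ 2"
    by (simp add: power2_eq_square algebra_simps)
  then have "px (f0^2 + f1^2 * A - (f2^2 + f3^2 * A) * B)
      + px (2 * (f0 * f1 - f2 * f3 * B)) * v2 = 0"
    unfolding vA vB
    by (simp add: fls.pev_diff fls.pev_add fls.pev_mult power2_eq_square algebra_simps)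
  from no_v2[OF this] have eq: "f0^2 + f1^2 * A = (f2^2 + f3^2 * A) * B" "f0 * f1 = f2 * f3 * B"
    by simp_all
  have half: "x = p" "y = q" if "x + y = p + q" "x - y = p - q" for x y p q :: "complex poly"
  proof -
    have *: "2 * x = (x + y) + (x - y)" "2 * p = (p + q) + (p - q)" by simp_all
    have "2 * x = 2 * p" by (simp only: * that)
    then show "x = p" by simp
    then show "y = q" using that(1) by simp
  qed
  \<comment> \<open>The pairs f0^2, f1^2 A and f2^2 B, f3^2 A B have equal sums and equal products,
    so their squared differences agree by (x - y)^2 = (x + y)^2 - 4 x y.\<close>
  have "(f0^2 - f1^2 * A) ^ 2 = (f0^2 + f1^2 * A) ^ 2 - 4 * A * (f0 * f1) ^ 2"
    by (simp add: power2_eq_square algebra_simps)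
  also have "\<dots> = ((f2^2 - f3^2 * A) * B) ^ 2"
    unfolding eq by (simp add: power2_eq_square algebra_simps)
  finally
  consider "f0^2 - f1^2 * A = (f2^2 - f3^2 * A) * B" | "f0^2 - f1^2 * A = - ((f2^2 - f3^2 * A) * B)"
    by (auto simp: power2_eq_iff)
  then show ?thesis
  proof cases
    case 1
    have "f0^2 = B * f2^2" "A * f1^2 = A * (B * f3^2)"
      using half[of "f0^2" "f1^2 * A" "f2^2 * B" "f3^2 * A * B"] eq(1) 1
      by (simp_all add: algebra_simps)
    then have "f0^2 = B * f2^2" "f1^2 = B * f3^2" using nz by auto
    then show ?thesis using square_eq_simple_root_mult_square B1 nz by blast
  next
    case 2
    have "f0^2 = A * B * f3^2" and h: "A * f1^2 = B * f2^2"
      using half[of "f0^2" "f1^2 * A" "f3^2 * A * B" "f2^2 * B"] eq(1) 2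
      by (simp_all add: algebra_simps)
    then have "f0 = 0 \<and> f3 = 0" using square_eq_simple_root_mult_square AB1 nz no_zero_divisors by metis
    \<comment> \<open>Multiplying \<open>h\<close> by \<open>A\<close> completes the left-hand side
      to a square and leaves \<open>A * B\<close> times a square on the right.\<close>
    moreover have "(A * f1) ^ 2 = A * B * f2 ^ 2"
      using h by (simp add: power_mult_distrib power2_eq_square ac_simps)
    then have "A * f1 = 0 \<and> f2 = 0" using square_eq_simple_root_mult_square AB1 nz no_zero_divisors by metis
    ultimately show ?thesis by simp
  qed
qed

section \<open>Substitution of series for the three variables\<close>

definition mon :: "nat \<times> nat \<times> nat \<Rightarrow> complex fls" where
  "mon m = fls_X ^ fst m * v2 ^ fst (snd m) * v3 ^ snd (snd m)"

definition theta :: "mpoly3 \<Rightarrow> complex fls" where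
  "theta p = (\<Sum>m\<in>Poly_Mapping.keys p. fls_const (Poly_Mapping.lookup p m) * mon m)"

lemma mon_add: "mon (m + n) = mon m * mon n"
  by (simp add: mon_def power_add algebra_simps)

lemma theta_superset:
  "finite A \<Longrightarrow> Poly_Mapping.keys p \<subseteq> A \<Longrightarrow> theta p = (\<Sum>m\<in>A. fls_const (Poly_Mapping.lookup p m) * mon m)"
  unfolding theta_def by (intro sum.mono_neutral_left) (auto simp: in_keys_iff)

lemma theta_add: "theta (p + q) = theta p + theta q"
proof -
  let ?A = "Poly_Mapping.keys p \<union> Poly_Mapping.keys q"
  have "theta (p + q) = (\<Sum>m\<in>?A. fls_const (Poly_Mapping.lookup (p + q) m) * mon m)"
    using keys_add[of p q] by (intro theta_superset) auto
  also have "\<dots> = theta p + theta q"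
    by (simp add: theta_superset[of ?A p] theta_superset[of ?A q] lookup_add
        fls_plus_const[symmetric] distrib_right sum.distrib)
  finally show ?thesis .
qed

lemma theta_single: "theta (Poly_Mapping.single m k) = fls_const k * mon m"
  by (subst theta_superset[of "{m}"]) auto

lemma theta_mult: "theta (p * q) = theta p * theta q"
proof (induction p rule: mpoly3_induct)
  case (single m k)
  show ?case
    by (induction q rule: mpoly3_induct)
      (simp_all add: mult_single theta_single mon_add theta_add algebra_simps)
qed (simp add: distrib_right theta_add)

lemma theta_0 [simp]: "theta 0 = 0"
  by (simp add: theta_def)

lemma theta_uminus: "theta (- p) = - theta p"
  using theta_add[of p "- p"] by (simp add: eq_neg_iff_add_eq_0 add.commute)

lemma theta_diff: "theta (p - q) = theta p - theta q"
  using theta_add[of p "- q"] by (simp add: theta_uminus)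

lemma theta_mconst [simp]: "theta (mconst k) = fls_const k"
  by (simp add: mconst_def theta_single mon_def)

lemma theta_1 [simp]: "theta 1 = 1"
  using theta_mconst[of 1] by simp

lemma theta_mvar [simp]: "theta (mvar 1) = fls_X" "theta (mvar (Suc 0)) = fls_X"
    "theta (mvar 2) = v2" "theta (mvar 3) = v3"
  by (simp_all add: mvar_def theta_single mon_def)

lemma theta_pev: "theta (mp.pev (mvar i) f) = fls.pev (theta (mvar i)) f"
  by (induction f) (simp_all add: theta_add theta_mult)

section \<open>The ideal and normal forms modulo it\<close>

abbreviation "II \<equiv> Iideal e1 e2 e3"

lemma II_add: "a \<in> II \<Longrightarrow> b \<in> II \<Longrightarrow> a + b \<in> II"
  and II_mult: "a \<in> II \<Longrightarrow> r * a \<in> II"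
  unfolding Iideal_def by (auto intro: ideal_gen.intros)

lemma II_sq: "mvar 2 ^ 2 - (mvar 1 ^ 2 + mconst (e1 - e2)) \<in> II"
  "mvar 3 ^ 2 - (mvar 1 ^ 2 + mconst (e1 - e3)) \<in> II"
proof -
  have "mvar 2 ^ 2 - mvar 1 ^ 2 + mconst (epar e1 e2 e3 2 - epar e1 e2 e3 1) \<in> II"
    "mvar 3 ^ 2 - mvar 1 ^ 2 + mconst (epar e1 e2 e3 3 - epar e1 e2 e3 1) \<in> II"
    unfolding Iideal_def Igens_def by (rule ideal_gen.ig_gen; blast)+
  then show "mvar 2 ^ 2 - (mvar 1 ^ 2 + mconst (e1 - e2)) \<in> II"
    "mvar 3 ^ 2 - (mvar 1 ^ 2 + mconst (e1 - e3)) \<in> II"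
    by (simp_all add: epar_def mp.c_diff algebra_simps)
qed

lemma theta_II: "p \<in> II \<Longrightarrow> theta p = 0"
  unfolding Iideal_def
proof (induction rule: ideal_gen.induct)
  case (ig_gen g)
  then show ?case
    by (auto simp: Igens_def epar_def theta_add theta_diff theta_mult power2_eq_square
        v2_sq[unfolded power2_eq_square] v3_sq[unfolded power2_eq_square] fls_minus_const[symmetric])
qed (simp_all add: theta_add theta_mult)

abbreviation "pm \<equiv> mp.pev (mvar 1)"

definition normal_form :: "complex poly \<Rightarrow> complex poly \<Rightarrow> complex poly \<Rightarrow> complex poly \<Rightarrow> mpoly3" where
  "normal_form f0 f1 f2 f3 = pm f0 + pm f1 * mvar 2 + pm f2 * mvar 3 + pm f3 * mvar 2 * mvar 3"

text \<open>E is a free module of rank four over C[v1] with basis 1, v2, v3, v2 v3. The predicate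
  expresses the spanning half for one polynomial; \<open>independent_1_v2_v3\<close> is the other
  half.\<close>

definition reducible :: "mpoly3 \<Rightarrow> bool" where
  "reducible p \<longleftrightarrow> (\<exists>f0 f1 f2 f3. p - normal_form f0 f1 f2 f3 \<in> II)"

lemma reducible_add:
  assumes "reducible p" "reducible q"
  shows "reducible (p + q)"
proof -
  obtain f0 f1 f2 f3 g0 g1 g2 g3 where
    "p - normal_form f0 f1 f2 f3 \<in> II" "q - normal_form g0 g1 g2 g3 \<in> II"
    using assms unfolding reducible_def by blast
  then have "(p - normal_form f0 f1 f2 f3) + (q - normal_form g0 g1 g2 g3) \<in> II" by (rule II_add)
  also have "(p - normal_form f0 f1 f2 f3) + (q - normal_form g0 g1 g2 g3)
     = p + q - normal_form (f0 + g0) (f1 + g1) (f2 + g2) (f3 + g3)"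
    by (simp add: normal_form_def mp.pev_add algebra_simps)
  finally show ?thesis unfolding reducible_def by blast
qed

lemma reducible_mult_pm:
  assumes "reducible p"
  shows "reducible (pm g * p)"
proof -
  obtain f0 f1 f2 f3 where "p - normal_form f0 f1 f2 f3 \<in> II"
    using assms unfolding reducible_def by blast
  then have "pm g * (p - normal_form f0 f1 f2 f3) \<in> II" by (rule II_mult)
  also have "pm g * (p - normal_form f0 f1 f2 f3)
     = pm g * p - normal_form (g * f0) (g * f1) (g * f2) (g * f3)"
    by (simp add: normal_form_def mp.pev_mult algebra_simps)
  finally show ?thesis unfolding reducible_def by blast
qed

lemma reducible_mult_v2:
  assumes "reducible p"
  shows "reducible (mvar 2 * p)"
proof -
  obtain f0 f1 f2 f3 where "p - normal_form f0 f1 f2 f3 \<in> II"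
    using assms unfolding reducible_def by blast
  \<comment> \<open>Multiplication by v2 turns the terms of \<open>f1\<close> and \<open>f3\<close>
    into multiples of v2^2; the added multiple of the relation replaces v2^2 by its value in
    v1.\<close>
  then have "mvar 2 * (p - normal_form f0 f1 f2 f3)
     + (pm f1 + pm f3 * mvar 3) * (mvar 2 ^ 2 - (mvar 1 ^ 2 + mconst (e1 - e2))) \<in> II"
    by (intro II_add II_mult II_sq)
  also have "mvar 2 * (p - normal_form f0 f1 f2 f3)
     + (pm f1 + pm f3 * mvar 3) * (mvar 2 ^ 2 - (mvar 1 ^ 2 + mconst (e1 - e2)))
     = mvar 2 * p - normal_form ([:e1 - e2, 0, 1:] * f1) f0 ([:e1 - e2, 0, 1:] * f3) f2"
    unfolding normal_form_def mp.pev_mult by (simp add: power2_eq_square algebra_simps)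
  finally show ?thesis unfolding reducible_def by blast
qed

lemma reducible_mult_v3:
  assumes "reducible p"
  shows "reducible (mvar 3 * p)"
proof -
  obtain f0 f1 f2 f3 where "p - normal_form f0 f1 f2 f3 \<in> II"
    using assms unfolding reducible_def by blast
  then have "mvar 3 * (p - normal_form f0 f1 f2 f3)
     + (pm f2 + pm f3 * mvar 2) * (mvar 3 ^ 2 - (mvar 1 ^ 2 + mconst (e1 - e3))) \<in> II"
    by (intro II_add II_mult II_sq)
  also have "mvar 3 * (p - normal_form f0 f1 f2 f3)
     + (pm f2 + pm f3 * mvar 2) * (mvar 3 ^ 2 - (mvar 1 ^ 2 + mconst (e1 - e3)))
     = mvar 3 * p - normal_form ([:e1 - e3, 0, 1:] * f2) ([:e1 - e3, 0, 1:] * f3) f0 f1"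
    unfolding normal_form_def mp.pev_mult by (simp add: power2_eq_square algebra_simps)
  finally show ?thesis unfolding reducible_def by blast
qed

lemma reducible_1: "reducible 1"
proof -
  have "1 - normal_form 1 0 0 0 = 0" by (simp add: normal_form_def)
  then have "1 - normal_form 1 0 0 0 \<in> II" by (simp add: Iideal_def ideal_gen.ig_zero)
  then show ?thesis unfolding reducible_def by blast
qed

lemma reducible_all: "reducible p"
proof (induction p rule: mpoly3_induct)
  case (single m k)
  obtain a b d where m: "m = (a, b, d)" by (cases m)
  have 1: "reducible (mvar 3 ^ d)"
    by (induction d) (simp_all add: reducible_1 reducible_mult_v3)
  have 2: "reducible (mvar 2 ^ b * mvar 3 ^ d)"
    using 1 by (induction b) (simp_all add: reducible_mult_v2 mult.assoc)
  have "reducible (mvar 1 ^ a * (mvar 2 ^ b * mvar 3 ^ d))"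
  proof (induction a)
    case (Suc a)
    then show ?case using reducible_mult_pm[of _ "[:0, 1:]"] by (simp add: mult.assoc)
  qed (simp add: 2)
  then show ?case
    using reducible_mult_pm[of _ "[:k:]"] by (simp add: m single_eq_mvar_power mult.assoc)
qed (rule reducible_add)

text \<open>In the nontrivial direction only a normal form has to be examined, and its image
  vanishes only if all four coefficients do. The cosets forming E are therefore the nonempty fibres
  of \<open>theta\<close>.\<close>

lemma theta_eq_0_iff: "theta p = 0 \<longleftrightarrow> p \<in> II"
proof
  assume p: "theta p = 0"
  obtain f0 f1 f2 f3 where f: "p - normal_form f0 f1 f2 f3 \<in> II"
    using reducible_all unfolding reducible_def by blast
  then have "theta (normal_form f0 f1 f2 f3) = 0"
    using theta_II p by (fastforce simp: theta_diff)
  then have "f0 = 0 \<and> f1 = 0 \<and> f2 = 0 \<and> f3 = 0"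
    by (intro independent_1_v2_v3) (simp add: normal_form_def theta_add theta_mult theta_pev)
  then show "p \<in> II" using f by (simp add: normal_form_def)
qed (rule theta_II)

end

section \<open>The Lie algebra inside triples of Laurent series\<close>

type_synonym vec3 = "complex fls \<times> complex fls \<times> complex fls"

definition sm :: "complex fls \<Rightarrow> vec3 \<Rightarrow> vec3" where
  "sm q w = (q * fst w, q * fst (snd w), q * snd (snd w))"

definition cross :: "vec3 \<Rightarrow> vec3 \<Rightarrow> vec3" where
  "cross v w = (fst (snd v) * snd (snd w) - snd (snd v) * fst (snd w),
     snd (snd v) * fst w - fst v * snd (snd w), fst v * fst (snd w) - fst (snd v) * fst w)"

lemma sm_Pair [simp]: "sm q (a, b, c) = (q * a, q * b, q * c)"
  by (simp add: sm_def)

lemma cross_Pair [simp]: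
  "cross (a1, a2, a3) (b1, b2, b3) = (a2 * b3 - a3 * b2, a3 * b1 - a1 * b3, a1 * b2 - a2 * b1)"
  by (simp add: cross_def)

lemma sm_add_right: "sm q (v + w) = sm q v + sm q w"
  and sm_add_left: "sm (q + r) w = sm q w + sm r w"
  and sm_sm: "sm q (sm r w) = sm (q * r) w"
  and sm_1 [simp]: "sm 1 w = w"
  and sm_0 [simp]: "sm 0 w = 0"
  and sm_0_right [simp]: "sm q 0 = 0"
  by (simp_all add: sm_def prod_eq_iff algebra_simps)

lemma sm_eq_0_iff: "sm q w = 0 \<longleftrightarrow> q = 0 \<or> w = 0"
  by (auto simp: sm_def prod_eq_iff)

lemma cross_sm_left: "cross (sm q v) w = sm q (cross v w)"
  and cross_sm_right: "cross v (sm q w) = sm q (cross v w)"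
  and cross_anticomm: "cross v w = sm (- 1) (cross w v)"
  by (simp_all add: sm_def cross_def prod_eq_iff algebra_simps)

text \<open>Vectors are multiplied by arbitrary series through \<open>sm\<close>, but dimension is
  counted over the complex numbers, embedded as constant series.\<close>

interpretation cv: finite_codimension "\<lambda>c. sm (fls_const c)"
  by standard (simp_all add: sm_add_right sm_add_left sm_sm fls_plus_const[symmetric])

text \<open>These are the partial multipliers of \<open>W\<close>. For a subspace they are closed
  under sums and products, so that membership of a whole field can be checked on generators and
  inverses of linear polynomials.\<close>

definition mults :: "vec3 set \<Rightarrow> complex fls set" where
  "mults W = {q. cv.fincodim {w \<in> W. sm q w \<in> W} W}"

lemma subspace_mult_vimage:
  assumes "cv.vs.subspace S" "cv.vs.subspace W"
  shows "cv.vs.subspace {w \<in> S. sm q w \<in> W}"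
proof -
  have "sm q (sm (fls_const c) w) = sm (fls_const c) (sm q w)" for c w
    by (simp add: sm_sm mult.commute)
  then show ?thesis
    using assms unfolding cv.vs.subspace_def by (auto simp: sm_add_right)
qed

lemma fincodim_mult_vimage:
  assumes "cv.fincodim N W" "cv.vs.subspace S" "cv.vs.subspace N" "\<And>w. w \<in> S \<Longrightarrow> sm q w \<in> W"
  shows "cv.fincodim {w \<in> S. sm q w \<in> N} S"
proof (rule cv.fincodim_vimage[OF assms(1-3)])
  show "sm q (sm (fls_const c) w) = sm (fls_const c) (sm q w)" for c w
    by (simp add: sm_sm mult.commute)
qed (use assms(4) sm_add_right in auto)

lemma mults_add:
  assumes W: "cv.vs.subspace W" and "q \<in> mults W" "r \<in> mults W"
  shows "q + r \<in> mults W"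
proof -
  let ?S = "\<lambda>q. {w \<in> W. sm q w \<in> W}"
  have "cv.fincodim (?S q \<inter> ?S r) (?S q)"
    using assms by (intro cv.fincodim_Int[of _ W] subspace_mult_vimage) (auto simp: mults_def)
  then have "cv.fincodim (?S q \<inter> ?S r) W"
    by (rule cv.fincodim_trans[of _ "?S q"]) (use assms(2) in \<open>auto simp: mults_def\<close>)
  moreover have "?S q \<inter> ?S r \<subseteq> ?S (q + r)"
    using W by (intro subsetI) (simp add: sm_add_left cv.vs.subspace_add)
  ultimately show ?thesis
    unfolding mults_def using cv.fincodim_mono by blast
qed

text \<open>Composition of partial maps: the domain shrinks to the vectors that multiplication by
  \<open>r\<close> carries into the domain for \<open>q\<close>, a preimage of a subspace of finite
  codimension.\<close>

lemma mults_mult: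
  assumes W: "cv.vs.subspace W" and "q \<in> mults W" "r \<in> mults W"
  shows "q * r \<in> mults W"
proof -
  let ?S = "\<lambda>q. {w \<in> W. sm q w \<in> W}"
  have "cv.fincodim {w \<in> ?S r. sm r w \<in> ?S q} (?S r)"
    using assms by (intro fincodim_mult_vimage[of "?S q" W "?S r" r] subspace_mult_vimage) (auto simp: mults_def)
  then have "cv.fincodim {w \<in> ?S r. sm r w \<in> ?S q} W"
    by (rule cv.fincodim_trans[of _ "?S r"]) (use assms(3) in \<open>auto simp: mults_def\<close>)
  moreover have "{w \<in> ?S r. sm r w \<in> ?S q} \<subseteq> ?S (q * r)"
    by (intro subsetI) (simp add: sm_sm)
  ultimately show ?thesis
    unfolding mults_def using cv.fincodim_mono by blast
qed

lemma multsI: "(\<And>w. w \<in> W \<Longrightarrow> sm q w \<in> W) \<Longrightarrow> q \<in> mults W"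
proof -
  assume "\<And>w. w \<in> W \<Longrightarrow> sm q w \<in> W"
  then have "{w \<in> W. sm q w \<in> W} = W" by auto
  then show ?thesis by (simp add: mults_def cv.fincodim_refl)
qed

text \<open>Two restrictions of finite codimension are made: to the vectors of \<open>S\<close> that
  \<open>q\<close> keeps in \<open>W\<close>, then to those whose image falls into \<open>S\<close>.
  This passes from the whole Lie algebra to L.\<close>

lemma mults_fincodim_subset:
  assumes "q \<in> mults W" "cv.vs.subspace W" "cv.vs.subspace S" "S \<subseteq> W" "cv.fincodim S W"
  shows "q \<in> mults S"
proof -
  let ?N = "{w \<in> W. sm q w \<in> W}"
  have N: "cv.fincodim ?N W" "cv.vs.subspace ?N"
    using assms by (auto simp: mults_def intro: subspace_mult_vimage)
  have 1: "cv.fincodim (S \<inter> ?N) S"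
    using N assms by (intro cv.fincodim_Int[of _ W])
  have "cv.fincodim {w \<in> S \<inter> ?N. sm q w \<in> S} (S \<inter> ?N)"
    using N assms by (intro fincodim_mult_vimage[of S W] cv.vs.subspace_inter) auto
  then have "cv.fincodim {w \<in> S \<inter> ?N. sm q w \<in> S} S"
    using 1 by (rule cv.fincodim_trans) simp
  then show ?thesis
    unfolding mults_def by (auto elim: cv.fincodim_mono)
qed

lemma cross_eq_0_imp_sm:
  assumes "cross v p = 0" "p \<noteq> 0"
  obtains q where "v = sm q p"
proof -
  obtain a b c where v: "v = (a, b, c)" by (cases v)
  obtain x y' z' where p: "p = (x, y', z')" by (cases p)
  have eq: "b * z' = c * y'" "c * x = a * z'" "a * y' = b * x"
    using assms(1) by (simp_all add: v p zero_prod_def)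
  consider "x \<noteq> 0" | "y' \<noteq> 0" | "z' \<noteq> 0" using assms(2) by (auto simp: p zero_prod_def)
  then show ?thesis
  proof cases
    case 1
    then show ?thesis using eq by (intro that[of "a / x"]) (simp add: v p field_simps)
  next
    case 2
    then show ?thesis using eq by (intro that[of "b / y'"]) (simp add: v p field_simps)
  next
    case 3
    then show ?thesis using eq by (intro that[of "c / z'"]) (simp add: v p field_simps)
  qed
qed

text \<open>Made for operations on classes that are defined as unions over representatives: the
  second premise is their well-definedness, and the first excludes an empty union.\<close>

lemma UNION_const1:
  assumes "X \<noteq> {}" "\<And>a b. (a, b) \<in> X \<Longrightarrow> F a b = C"
  shows "(\<Union>(a, b)\<in>X. F a b) = C"
proof -
  have "(\<Union>(a, b)\<in>X. F a b) = (\<Union>P\<in>X. C)"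
    using assms(2) by (intro SUP_cong) auto
  then show ?thesis using assms(1) by simp
qed

lemma UNION_const2:
  assumes "X \<noteq> {}" "Y \<noteq> {}" "\<And>a b c d. (a, b) \<in> X \<Longrightarrow> (c, d) \<in> Y \<Longrightarrow> F a b c d = C"
  shows "(\<Union>(a, b)\<in>X. \<Union>(c, d)\<in>Y. F a b c d) = C"
  using assms by (intro UNION_const1) auto

section \<open>Cosets as fibres of the substitution map\<close>

context curve_series
begin

definition RE :: "complex fls set" where "RE = range theta"

definition fib :: "complex fls \<Rightarrow> Eel" where "fib a = {p. theta p = a}"

lemma Ecl_eq_fib: "Ecl e1 e2 e3 p = fib (theta p)"
  by (auto simp: Ecl_def fib_def theta_eq_0_iff[symmetric] theta_diff)

text \<open>One membership suffices: \<open>fib a\<close> is then nonempty, and fibres over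
  different values are disjoint.\<close>

lemma fib_eq_iff: "a \<in> RE \<Longrightarrow> fib a = fib b \<longleftrightarrow> a = b"
  by (auto simp: RE_def fib_def)

lemma RE_closed:
  shows RE_add: "a \<in> RE \<Longrightarrow> b \<in> RE \<Longrightarrow> a + b \<in> RE"
    and RE_diff: "a \<in> RE \<Longrightarrow> b \<in> RE \<Longrightarrow> a - b \<in> RE"
    and RE_mult: "a \<in> RE \<Longrightarrow> b \<in> RE \<Longrightarrow> a * b \<in> RE"
    and RE_const: "fls_const k \<in> RE"
    and RE_0: "0 \<in> RE" and RE_1: "1 \<in> RE"
    and RE_X: "fls_X \<in> RE" and RE_v2: "v2 \<in> RE" and RE_v3: "v3 \<in> RE"
  unfolding RE_def
  by (auto simp: theta_add[symmetric] theta_diff[symmetric] theta_mult[symmetric])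
    (metis rangeI theta_mconst theta_0 theta_1 theta_mvar)+

lemma Eset_eq: "Eset e1 e2 e3 = fib ` RE"
  by (auto simp: Eset_def Ecl_eq_fib RE_def)

text \<open>All representatives in \<open>fib a\<close> have the same image under
  \<open>theta\<close>, so the union over representatives collapses to a single fibre.\<close>

lemma Eop2_fib:
  assumes "\<And>p q. theta (f p q) = g (theta p) (theta q)" "a \<in> RE" "b \<in> RE"
  shows "Eop2 e1 e2 e3 f (fib a) (fib b) = fib (g a b)"
proof -
  obtain p q where "a = theta p" "b = theta q" using assms(2,3) by (auto simp: RE_def)
  then show ?thesis
    by (auto simp: Eop2_def Ecl_eq_fib assms(1)) (auto simp: fib_def)
qed

lemma Eadd_fib: "a \<in> RE \<Longrightarrow> b \<in> RE \<Longrightarrow> Eadd e1 e2 e3 (fib a) (fib b) = fib (a + b)"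
  unfolding Eadd_def by (rule Eop2_fib) (simp_all add: theta_add)

lemma Esub_fib: "a \<in> RE \<Longrightarrow> b \<in> RE \<Longrightarrow> Esub e1 e2 e3 (fib a) (fib b) = fib (a - b)"
  unfolding Esub_def by (rule Eop2_fib) (simp_all add: theta_diff)

lemma Emul_fib: "a \<in> RE \<Longrightarrow> b \<in> RE \<Longrightarrow> Emul e1 e2 e3 (fib a) (fib b) = fib (a * b)"
  unfolding Emul_def by (rule Eop2_fib) (simp_all add: theta_mult)

lemma Escale_fib: "a \<in> RE \<Longrightarrow> Escale e1 e2 e3 k (fib a) = fib (fls_const k * a)"
proof -
  assume "a \<in> RE"
  then obtain p where "a = theta p" by (auto simp: RE_def)
  then show ?thesis
    by (auto simp: Escale_def Ecl_eq_fib theta_mult) (auto simp: fib_def)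
qed

definition RE3 :: "vec3 set" where "RE3 = RE \<times> RE \<times> RE"

definition tau :: "vec3 \<Rightarrow> tens" where
  "tau w = (fib (fst w), fib (fst (snd w)), fib (snd (snd w)))"

lemma inj_on_tau: "inj_on tau RE3"
  by (auto simp: inj_on_def RE3_def tau_def fib_eq_iff)

lemma tau_zero: "tzero e1 e2 e3 = tau 0"
  by (simp add: tzero_def tau_def Ecl_eq_fib)

lemma tau_add: "v \<in> RE3 \<Longrightarrow> w \<in> RE3 \<Longrightarrow> tadd e1 e2 e3 (tau v) (tau w) = tau (v + w)"
  by (auto simp: tadd_def tau_def RE3_def Eadd_fib)

lemma tau_smul: "w \<in> RE3 \<Longrightarrow> tsmul e1 e2 e3 k (tau w) = tau (sm (fls_const k) w)"
  by (auto simp: tsmul_def tau_def RE3_def Escale_fib)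

lemma tau_cross: "v \<in> RE3 \<Longrightarrow> w \<in> RE3 \<Longrightarrow> tbr e1 e2 e3 (tau v) (tau w) = tau (cross v w)"
  by (auto simp: tbr_def tau_def RE3_def Esub_fib Emul_fib RE_mult)

lemma RE3_closed:
  shows RE3_add: "v \<in> RE3 \<Longrightarrow> w \<in> RE3 \<Longrightarrow> v + w \<in> RE3"
    and RE3_sm: "q \<in> RE \<Longrightarrow> w \<in> RE3 \<Longrightarrow> sm q w \<in> RE3"
    and RE3_cross: "v \<in> RE3 \<Longrightarrow> w \<in> RE3 \<Longrightarrow> cross v w \<in> RE3"
  by (auto simp: RE3_def RE_add RE_mult RE_diff)

section \<open>The Lie algebra as a product of three modules over C[z]\<close>

definition z :: "complex fls" where "z = fls_X ^ 2 + fls_const e1"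
definition y :: "complex fls" where "y = fls_X * v2 * v3"

abbreviation "ez \<equiv> fls.pev z"

lemma square_eq:
  "fls_X ^ 2 = z - fls_const e1" "v2 ^ 2 = z - fls_const e2" "v3 ^ 2 = z - fls_const e3"
  by (simp_all add: z_def v2_sq v3_sq fls_minus_const[symmetric])

text \<open>The three coordinates arise from cyclic permutations of v1, v2, v3 in the arguments, so
  each fact about the modules is proved once and used three times.\<close>

definition Mod :: "complex fls \<Rightarrow> complex fls \<Rightarrow> complex fls \<Rightarrow> complex fls set" where
  "Mod u v w = {u * ez f + v * w * ez g | f g. True}"

lemma Mod_0: "0 \<in> Mod u v w"
proof -
  have "0 = u * ez 0 + v * w * ez 0" by simp
  then show ?thesis unfolding Mod_def by blast
qed

lemma Mod_add: "a \<in> Mod u v w \<Longrightarrow> b \<in> Mod u v w \<Longrightarrow> a + b \<in> Mod u v w"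
proof -
  assume "a \<in> Mod u v w" "b \<in> Mod u v w"
  then obtain f g f' g' where "a = u * ez f + v * w * ez g" "b = u * ez f' + v * w * ez g'"
    unfolding Mod_def by blast
  then have "a + b = u * ez (f + f') + v * w * ez (g + g')"
    by (simp add: fls.pev_add algebra_simps)
  then show ?thesis unfolding Mod_def by blast
qed

lemma Mod_ez: "a \<in> Mod u v w \<Longrightarrow> ez h * a \<in> Mod u v w"
proof -
  assume "a \<in> Mod u v w"
  then obtain f g where "a = u * ez f + v * w * ez g"
    unfolding Mod_def by blast
  then have "ez h * a = u * ez (h * f) + v * w * ez (h * g)"
    by (simp add: fls.pev_mult algebra_simps)
  then show ?thesis unfolding Mod_def by blast
qed

lemma Mod_const: "a \<in> Mod u v w \<Longrightarrow> fls_const k * a \<in> Mod u v w"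
  using Mod_ez[of a u v w "[:k:]"] by simp

lemma Mod_diff: "a \<in> Mod u v w \<Longrightarrow> b \<in> Mod u v w \<Longrightarrow> a - b \<in> Mod u v w"
  using Mod_add[of a u v w "fls_const (- 1) * b"] Mod_const[of b u v w "- 1"] by simp

text \<open>On generators: \<open>u * v\<close> is the second generator of the target,
  \<open>u * (w * u)\<close> and \<open>(v * w) * v\<close> are \<open>w\<close> times
  \<open>u ^ 2\<close> and \<open>v ^ 2\<close>, and \<open>(v * w) * (w * u)\<close> is
  \<open>u * v\<close> times \<open>w ^ 2\<close>; the squares are linear in z.\<close>

lemma Mod_mult:
  assumes sq: "u ^ 2 = z - fls_const k1" "v ^ 2 = z - fls_const k2" "w ^ 2 = z - fls_const k3"
    and "a \<in> Mod u v w" "b \<in> Mod v w u"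
  shows "a * b \<in> Mod w u v"
proof -
  obtain f g f' g' where ab: "a = u * ez f + v * w * ez g" "b = v * ez f' + w * u * ez g'"
    using assms(4,5) unfolding Mod_def by blast
  have lin: "ez [:-k1, 1:] = u ^ 2" "ez [:-k2, 1:] = v ^ 2" "ez [:-k3, 1:] = w ^ 2"
    by (simp_all add: sq)
  have "a * b = w * ez ([:-k1, 1:] * f * g' + [:-k2, 1:] * g * f')
      + u * v * ez (f * f' + [:-k3, 1:] * g * g')"
    unfolding ab fls.pev_add fls.pev_mult lin by (simp add: power2_eq_square algebra_simps)
  then show ?thesis unfolding Mod_def by blast
qed

text \<open>Multiplication by \<open>u * v * w\<close> interchanges the two generators up to
  squares, which are polynomials in z.\<close>

lemma Mod_y:
  assumes sq: "u ^ 2 = z - fls_const k1" "v ^ 2 = z - fls_const k2" "w ^ 2 = z - fls_const k3"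
    and "a \<in> Mod u v w"
  shows "u * v * w * a \<in> Mod u v w"
proof -
  obtain f g where a: "a = u * ez f + v * w * ez g"
    using assms(4) unfolding Mod_def by blast
  have lin: "ez [:-k1, 1:] = u ^ 2" "ez [:-k2, 1:] = v ^ 2" "ez [:-k3, 1:] = w ^ 2"
    by (simp_all add: sq)
  have "u * v * w * a = u * ez ([:-k2, 1:] * [:-k3, 1:] * g) + v * w * ez ([:-k1, 1:] * f)"
    unfolding a fls.pev_mult lin by (simp add: power2_eq_square algebra_simps)
  then show ?thesis unfolding Mod_def by blast
qed

definition R0 :: "vec3 set" where
  "R0 = Mod fls_X v2 v3 \<times> Mod v2 v3 fls_X \<times> Mod v3 fls_X v2"

lemma R0_add: "v \<in> R0 \<Longrightarrow> w \<in> R0 \<Longrightarrow> v + w \<in> R0"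
  by (auto simp: R0_def Mod_add)

lemma R0_ez: "w \<in> R0 \<Longrightarrow> sm (ez h) w \<in> R0"
  by (auto simp: R0_def Mod_ez)

lemma R0_const: "w \<in> R0 \<Longrightarrow> sm (fls_const k) w \<in> R0"
  by (auto simp: R0_def Mod_const)

lemma R0_0: "0 \<in> R0"
  by (simp add: R0_def Mod_0 zero_prod_def)

lemma subspace_R0: "cv.vs.subspace R0"
  by (simp add: cv.vs.subspace_def R0_0 R0_add R0_const)

lemma R0_y: "w \<in> R0 \<Longrightarrow> sm y w \<in> R0"
  using Mod_y[OF square_eq(1,2,3)] Mod_y[OF square_eq(2,3,1)] Mod_y[OF square_eq(3,1,2)]
  by (auto simp: R0_def y_def mult_ac)

lemma R0_cross: "v \<in> R0 \<Longrightarrow> w \<in> R0 \<Longrightarrow> cross v w \<in> R0"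
proof -
  have *: "a * b \<in> Mod v3 fls_X v2" "b * a \<in> Mod v3 fls_X v2"
    if "a \<in> Mod fls_X v2 v3" "b \<in> Mod v2 v3 fls_X" for a b
    using Mod_mult[OF square_eq(1,2,3) that] by (simp_all add: mult.commute)
  have **: "a * b \<in> Mod fls_X v2 v3" "b * a \<in> Mod fls_X v2 v3"
    if "a \<in> Mod v2 v3 fls_X" "b \<in> Mod v3 fls_X v2" for a b
    using Mod_mult[OF square_eq(2,3,1) that] by (simp_all add: mult.commute)
  have ***: "a * b \<in> Mod v2 v3 fls_X" "b * a \<in> Mod v2 v3 fls_X"
    if "a \<in> Mod v3 fls_X v2" "b \<in> Mod fls_X v2 v3" for a b
    using Mod_mult[OF square_eq(3,1,2) that] by (simp_all add: mult.commute)
  assume "v \<in> R0" "w \<in> R0"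
  then show ?thesis
    by (auto simp: R0_def intro!: Mod_diff intro: * ** ***)
qed

lemma RE_z: "z \<in> RE"
  unfolding z_def power2_eq_square by (intro RE_closed)

lemma RE_y: "y \<in> RE"
  unfolding y_def by (intro RE_closed)

lemma RE_ez: "ez f \<in> RE"
  by (induction f) (auto simp: RE_closed RE_z)

lemma R0_subset_RE3: "R0 \<subseteq> RE3"
  by (auto simp: R0_def RE3_def Mod_def RE_closed RE_ez)

lemma R0_v: "(fls_X, 0, 0) \<in> R0" "(0, v2, 0) \<in> R0" "(0, 0, v3) \<in> R0"
proof -
  have "u \<in> Mod u v w" for u v w
  proof -
    have "u = u * ez 1 + v * w * ez 0" by simp
    then show ?thesis unfolding Mod_def by blast
  qed
  then show "(fls_X, 0, 0) \<in> R0" "(0, v2, 0) \<in> R0" "(0, 0, v3) \<in> R0"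
    by (simp_all add: R0_def Mod_0)
qed

lemma Rgen_subset: "x \<in> Rgen e1 e2 e3 \<Longrightarrow> x \<in> tau ` R0"
proof (induction rule: Rgen.induct)
  case R_zero
  then show ?case using R0_0 by (simp add: tau_zero)
next
  case R_gen1
  then show ?case using R0_v(1)
    by (intro image_eqI[of _ _ "(fls_X, 0, 0)"]) (simp_all add: Ehat_def tau_def Ecl_eq_fib)
next
  case R_gen2
  then show ?case using R0_v(2)
    by (intro image_eqI[of _ _ "(0, v2, 0)"]) (simp_all add: Ehat_def tau_def Ecl_eq_fib)
next
  case R_gen3
  then show ?case using R0_v(3)
    by (intro image_eqI[of _ _ "(0, 0, v3)"]) (simp_all add: Ehat_def tau_def Ecl_eq_fib)
next
  case (R_add v w)
  then obtain v' w' where "v = tau v'" "v' \<in> R0" "w = tau w'" "w' \<in> R0" by blast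
  then show ?case by (simp add: tau_add subsetD[OF R0_subset_RE3] R0_add)
next
  case (R_smul w k)
  then obtain w' where "w = tau w'" "w' \<in> R0" by blast
  then show ?case by (simp add: tau_smul subsetD[OF R0_subset_RE3] R0_const)
next
  case (R_br v w)
  then obtain v' w' where "v = tau v'" "v' \<in> R0" "w = tau w'" "w' \<in> R0" by blast
  then show ?case by (simp add: tau_cross subsetD[OF R0_subset_RE3] R0_cross)
qed

text \<open>The preimage under \<open>tau\<close> lets the inclusion opposite to
  \<open>Rgen_subset\<close> be proved with series, producing elements by cross products.\<close>

definition R1 :: "vec3 set" where "R1 = {w \<in> RE3. tau w \<in> Rgen e1 e2 e3}"

lemma R1_closed:
  shows R1_add: "v \<in> R1 \<Longrightarrow> w \<in> R1 \<Longrightarrow> v + w \<in> R1"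
    and R1_const: "w \<in> R1 \<Longrightarrow> sm (fls_const k) w \<in> R1"
    and R1_cross: "v \<in> R1 \<Longrightarrow> w \<in> R1 \<Longrightarrow> cross v w \<in> R1"
  unfolding R1_def
  by (auto simp: tau_add[symmetric] tau_smul[symmetric] tau_cross[symmetric]
      intro: Rgen.intros RE3_closed RE_const)

lemma R1_v: "(fls_X, 0, 0) \<in> R1" "(0, v2, 0) \<in> R1" "(0, 0, v3) \<in> R1"
  using R_gen1[of e1 e2 e3] R_gen2[of e1 e2 e3] R_gen3[of e1 e2 e3]
  by (simp_all add: R1_def RE3_def RE_closed tau_def Ehat_def Ecl_eq_fib)

lemma
  shows R1_v_ez: "(fls_X * ez f, 0, 0) \<in> R1 \<and> (0, v2 * ez f, 0) \<in> R1 \<and> (0, 0, v3 * ez f) \<in> R1"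
    and R1_vv_ez: "(v2 * v3 * ez f, 0, 0) \<in> R1 \<and> (0, v3 * fls_X * ez f, 0) \<in> R1
       \<and> (0, 0, fls_X * v2 * ez f) \<in> R1"
proof -
  have vv: "(v2 * v3 * ez f, 0, 0) \<in> R1" "(0, v3 * fls_X * ez f, 0) \<in> R1"
       "(0, 0, fls_X * v2 * ez f) \<in> R1"
    if "(fls_X * ez f, 0, 0) \<in> R1 \<and> (0, v2 * ez f, 0) \<in> R1 \<and> (0, 0, v3 * ez f) \<in> R1" for f
  proof -
    have "cross (0, v2 * ez f, 0) (0, 0, v3) \<in> R1" "cross (0, 0, v3 * ez f) (fls_X, 0, 0) \<in> R1"
      "cross (fls_X * ez f, 0, 0) (0, v2, 0) \<in> R1"
      using that R1_v by (blast intro: R1_cross)+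
    then show "(v2 * v3 * ez f, 0, 0) \<in> R1" "(0, v3 * fls_X * ez f, 0) \<in> R1"
       "(0, 0, fls_X * v2 * ez f) \<in> R1" by (simp_all add: mult_ac)
  qed
  show v: "(fls_X * ez f, 0, 0) \<in> R1 \<and> (0, v2 * ez f, 0) \<in> R1 \<and> (0, 0, v3 * ez f) \<in> R1" for f
  proof (induction f)
    case 0
    show ?case using R1_const[OF R1_v(1), of 0] by (simp add: zero_prod_def)
  next
    case (pCons k f)
    have zz: "z = v2 ^ 2 + fls_const e2" "z = v3 ^ 2 + fls_const e3" "z = fls_X ^ 2 + fls_const e1"
      using square_eq by simp_all
    \<comment> \<open>A double bracket multiplies by z up to a constant: [a2 v2, [a1 v1 f, a2 v2]] =
      a1 v1 v2^2 f with v2^2 = z - e2. The other summands restore e2 and add the constant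
      coefficient \<open>k\<close>. The remaining coordinates follow the same pattern with v3 and
      v1.\<close>
    have "cross (0, v2, 0) (0, 0, fls_X * v2 * ez f)
        + sm (fls_const e2) (fls_X * ez f, 0, 0) + sm (fls_const k) (fls_X, 0, 0) \<in> R1"
      by (intro R1_closed R1_v vv pCons.IH pCons.IH[THEN conjunct1])
    also have "cross (0, v2, 0) (0, 0, fls_X * v2 * ez f)
        + sm (fls_const e2) (fls_X * ez f, 0, 0) + sm (fls_const k) (fls_X, 0, 0)
        = (fls_X * ez (pCons k f), 0, 0)"
      unfolding fls.pev_pCons zz(1) by (simp add: power2_eq_square algebra_simps)
    finally have 1: "(fls_X * ez (pCons k f), 0, 0) \<in> R1" .
    have "cross (0, 0, v3) (v2 * v3 * ez f, 0, 0)
        + sm (fls_const e3) (0, v2 * ez f, 0) + sm (fls_const k) (0, v2, 0) \<in> R1"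
      by (intro R1_closed R1_v vv pCons.IH pCons.IH[THEN conjunct2, THEN conjunct1])
    also have "cross (0, 0, v3) (v2 * v3 * ez f, 0, 0)
        + sm (fls_const e3) (0, v2 * ez f, 0) + sm (fls_const k) (0, v2, 0)
        = (0, v2 * ez (pCons k f), 0)"
      unfolding fls.pev_pCons zz(2) by (simp add: power2_eq_square algebra_simps)
    finally have 2: "(0, v2 * ez (pCons k f), 0) \<in> R1" .
    have "cross (fls_X, 0, 0) (0, v3 * fls_X * ez f, 0)
        + sm (fls_const e1) (0, 0, v3 * ez f) + sm (fls_const k) (0, 0, v3) \<in> R1"
      by (intro R1_closed R1_v vv pCons.IH pCons.IH[THEN conjunct2, THEN conjunct2])
    also have "cross (fls_X, 0, 0) (0, v3 * fls_X * ez f, 0)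
        + sm (fls_const e1) (0, 0, v3 * ez f) + sm (fls_const k) (0, 0, v3)
        = (0, 0, v3 * ez (pCons k f))"
      unfolding fls.pev_pCons zz(3) by (simp add: power2_eq_square algebra_simps)
    finally have 3: "(0, 0, v3 * ez (pCons k f)) \<in> R1" .
    show ?case using 1 2 3 by blast
  qed
  show "(v2 * v3 * ez f, 0, 0) \<in> R1 \<and> (0, v3 * fls_X * ez f, 0) \<in> R1
       \<and> (0, 0, fls_X * v2 * ez f) \<in> R1"
    using vv[OF v] by blast
qed

lemma R0_subset_R1: "R0 \<subseteq> R1"
proof
  fix w assume "w \<in> R0"
  then obtain f1 g1 f2 g2 f3 g3 where w: "w = (fls_X * ez f1 + v2 * v3 * ez g1,
      v2 * ez f2 + v3 * fls_X * ez g2, v3 * ez f3 + fls_X * v2 * ez g3)"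
    unfolding R0_def Mod_def by blast
  have "(fls_X * ez f1, 0, 0) + (v2 * v3 * ez g1, 0, 0) + (0, v2 * ez f2, 0)
    + (0, v3 * fls_X * ez g2, 0) + (0, 0, v3 * ez f3) + (0, 0, fls_X * v2 * ez g3) \<in> R1"
    using R1_v_ez R1_vv_ez by (blast intro: R1_add)
  then show "w \<in> R1" by (simp add: w)
qed

lemma Rgen_eq: "Rgen e1 e2 e3 = tau ` R0"
  using Rgen_subset R0_subset_R1 by (auto simp: R1_def)

section \<open>The function field\<close>

text \<open>A normal form for C(z, y): y is a root of a quadratic polynomial over C(z), so
  numerators linear in y and denominators free of y suffice.\<close>

definition QF :: "complex fls set" where
  "QF = {(ez g + ez h * y) / ez f | f g h. ez f \<noteq> 0}"

definition cubic :: "complex poly" where "cubic = [:-e1, 1:] * [:-e2, 1:] * [:-e3, 1:]"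

lemma y_square: "y ^ 2 = ez cubic"
  unfolding cubic_def fls.pev_mult by (simp add: y_def power_mult_distrib square_eq)

lemma QF_I:
  assumes "ez f \<noteq> 0" "q * ez f = ez g + ez h * y"
  shows "q \<in> QF"
proof -
  have "q = (ez g + ez h * y) / ez f" using assms by (simp add: nonzero_eq_divide_eq)
  then show ?thesis using assms(1) unfolding QF_def by blast
qed

lemma QF_E:
  assumes "q \<in> QF"
  obtains f g h where "ez f \<noteq> 0" "q * ez f = ez g + ez h * y"
proof -
  obtain f g h where "ez f \<noteq> 0" "q = (ez g + ez h * y) / ez f"
    using assms unfolding QF_def by blast
  then show ?thesis by (intro that[of f g h]) simp_all
qed

lemma QF_ez_y: "ez g + ez h * y \<in> QF"
  by (rule QF_I[of 1 _ g h]) simp_all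

lemma QF_ez: "ez f \<in> QF"
  using QF_ez_y[of f 0] by simp

lemma QF_add:
  assumes "p \<in> QF" "q \<in> QF"
  shows "p + q \<in> QF"
proof -
  obtain f g h f' g' h' where *: "ez f \<noteq> 0" "p * ez f = ez g + ez h * y"
    "ez f' \<noteq> 0" "q * ez f' = ez g' + ez h' * y"
    using assms by (metis QF_E)
  have "(p + q) * ez (f * f') = (p * ez f) * ez f' + (q * ez f') * ez f"
    by (simp add: fls.pev_mult algebra_simps)
  also have "\<dots> = ez (g * f' + g' * f) + ez (h * f' + h' * f) * y"
    unfolding * by (simp add: fls.pev_mult fls.pev_add algebra_simps)
  finally show ?thesis using * by (intro QF_I[of "f * f'"]) (auto simp: fls.pev_mult)
qed

lemma QF_mult:
  assumes "p \<in> QF" "q \<in> QF"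
  shows "p * q \<in> QF"
proof -
  obtain f g h f' g' h' where *: "ez f \<noteq> 0" "p * ez f = ez g + ez h * y"
    "ez f' \<noteq> 0" "q * ez f' = ez g' + ez h' * y"
    using assms by (metis QF_E)
  have "(p * q) * ez (f * f') = (p * ez f) * (q * ez f')"
    by (simp add: fls.pev_mult algebra_simps)
  also have "\<dots> = ez (g * g' + h * h' * cubic) + ez (g * h' + h * g') * y"
    unfolding * fls.pev_mult fls.pev_add y_square[symmetric]
    by (simp add: power2_eq_square algebra_simps)
  finally show ?thesis using * by (intro QF_I[of "f * f'"]) (auto simp: fls.pev_mult)
qed

text \<open>Rationalisation: multiplying numerator and denominator of the reciprocal by the
  conjugate g - h y moves the denominator into C[z].\<close>

lemma QF_inverse:
  assumes "q \<in> QF"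
  shows "inverse q \<in> QF"
proof (cases "q = 0")
  case True
  then show ?thesis using QF_ez[of 0] by simp
next
  case False
  obtain f g h where *: "ez f \<noteq> 0" "q * ez f = ez g + ez h * y"
    using assms by (metis QF_E)
  show ?thesis
  proof (cases "ez g - ez h * y = 0")
    \<comment> \<open>A vanishing conjugate means h y = g, so the numerator g + h y is
      \<open>2 * g\<close> and lies in C[z] already.\<close>
    case True
    then have "q * ez f = ez (2 * g)" using * by (simp add: fls.pev_mult)
    moreover from this have "ez (2 * g) \<noteq> 0" using * False by (metis no_zero_divisors)
    ultimately show ?thesis using False
      by (intro QF_I[of "2 * g" _ f 0]) (simp_all add: field_simps)
  next
    case ne: False
    define N where "N = g ^ 2 - h ^ 2 * cubic"
    have N: "ez N = (q * ez f) * (ez g - ez h * y)"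
      unfolding N_def * fls.pev_diff fls.pev_mult y_square[symmetric] fls.pev_power
      by (simp add: power2_eq_square algebra_simps)
    have "ez N \<noteq> 0" unfolding N mult_eq_0_iff using ne *(1) False by simp
    moreover have "inverse q * ez N = ez f * (ez g - ez h * y)"
      unfolding N using False by (simp add: mult.assoc[symmetric])
    then have "inverse q * ez N = ez (f * g) + ez (- (f * h)) * y"
      by (simp add: fls.pev_mult fls.pev_uminus algebra_simps)
    ultimately show ?thesis by (rule QF_I)
  qed
qed

lemma QF_uminus: "q \<in> QF \<Longrightarrow> - q \<in> QF"
  using QF_mult[of "- 1" q] QF_ez[of "[:-1:]"] by (simp add: fls.c_uminus)

lemma v_nz: "v2 \<noteq> 0" "v3 \<noteq> 0"
  using independent_1_v2_v3[of 0 1 0 0] independent_1_v2_v3[of 0 0 1 0] by auto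

lemma multiplier_of_Mod:
  assumes sq: "u ^ 2 = z - fls_const k" and y: "u * v * w = y" and "u \<noteq> 0"
    and "m \<in> Mod u v w" "m \<noteq> 0" "q * m \<in> Mod u v w"
  shows "q \<in> QF"
proof -
  have *: "u * a \<in> QF" if a: "a \<in> Mod u v w" for a
  proof -
    obtain f g where "a = u * ez f + v * w * ez g" using a unfolding Mod_def by blast
    then have "u * a = u ^ 2 * ez f + (u * v * w) * ez g" by (simp add: power2_eq_square algebra_simps)
    also have "\<dots> = ez ([:-k, 1:] * f) + ez g * y"
      unfolding y sq fls.pev_mult by (simp add: algebra_simps)
    finally show ?thesis using QF_ez_y by simp
  qed
  have "q = (u * (q * m)) * inverse (u * m)" using assms(3,5) by (simp add: field_simps)
  then show ?thesis using QF_mult[OF *[OF assms(6)] QF_inverse[OF *[OF assms(4)]]] by (simp only:)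
qed

lemma multiplier_in_QF:
  assumes "p \<in> R0" "p \<noteq> 0" "sm q p \<in> R0"
  shows "q \<in> QF"
proof -
  obtain a b c where p: "p = (a, b, c)" by (cases p)
  consider "a \<noteq> 0" | "b \<noteq> 0" | "c \<noteq> 0" using assms(2) by (auto simp: p zero_prod_def)
  then show ?thesis
  proof cases
    case 1
    then show ?thesis using assms
      by (intro multiplier_of_Mod[OF square_eq(1), of v2 v3 a]) (auto simp: R0_def p y_def)
  next
    case 2
    then show ?thesis using assms v_nz
      by (intro multiplier_of_Mod[OF square_eq(2), of v3 fls_X b]) (auto simp: R0_def p y_def)
  next
    case 3
    then show ?thesis using assms v_nz
      by (intro multiplier_of_Mod[OF square_eq(3), of fls_X v2 c]) (auto simp: R0_def p y_def)
  qed
qed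

text \<open>Division by z - c in both polynomial coefficients leaves constant remainders, so two
  vectors span the module modulo z - c. Over three coordinates these are the six vectors
  \<open>?G\<close> of \<open>inverse_linear_mults\<close>.\<close>

lemma Mod_divide_linear:
  assumes "a \<in> Mod u v w"
  obtains b k l where "b \<in> Mod u v w"
    "a = ez [:-c, 1:] * b + fls_const k * u + fls_const l * (v * w)"
proof -
  obtain f g where a: "a = u * ez f + v * w * ez g" using assms unfolding Mod_def by blast
  have ev: "ez f = ez [:-c, 1:] * ez (synthetic_div f c) + fls_const (poly f c)" for f
  proof -
    have "ez f = ez ([:-c, 1:] * synthetic_div f c + [:poly f c:])"
      by (simp only: synthetic_div_correct')
    then show ?thesis unfolding fls.pev_add fls.pev_mult by simp
  qed
  let ?b = "u * ez (synthetic_div f c) + v * w * ez (synthetic_div g c)"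
  have "?b \<in> Mod u v w" unfolding Mod_def by blast
  moreover have "a = ez [:-c, 1:] * ?b + fls_const (poly f c) * u + fls_const (poly g c) * (v * w)"
    unfolding a ev[of f] ev[of g] by (simp add: algebra_simps)
  ultimately show ?thesis by (rule that)
qed

lemma inverse_linear_mults:
  assumes nz: "ez [:-c, 1:] \<noteq> 0"
  shows "inverse (ez [:-c, 1:]) \<in> mults R0"
proof -
  let ?t = "ez [:-c, 1:]" and ?v1 = "fls_X :: complex fls"
  let ?S = "{w \<in> R0. sm (inverse ?t) w \<in> R0}"
  let ?G = "{(?v1, 0, 0), (v2 * v3, 0, 0), (0, v2, 0), (0, v3 * ?v1, 0), (0, 0, v3), (0, 0, ?v1 * v2)}"
  have "?G \<subseteq> R0"
  proof -
    have "u \<in> Mod u v w" "v * w \<in> Mod u v w" for u v w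
    proof -
      have "u = u * ez 1 + v * w * ez 0" "v * w = u * ez 0 + v * w * ez 1" by simp_all
      then show "u \<in> Mod u v w" "v * w \<in> Mod u v w" unfolding Mod_def by blast+
    qed
    then show ?thesis by (simp add: R0_def Mod_0)
  qed
  moreover have "R0 \<subseteq> cv.vs.span (?S \<union> ?G)"
  proof
    fix w assume w: "w \<in> R0"
    obtain a1 a2 a3 where wa: "w = (a1, a2, a3)" by (cases w)
    obtain b1 k1 l1 b2 k2 l2 b3 k3 l3 where
      b: "b1 \<in> Mod ?v1 v2 v3" "b2 \<in> Mod v2 v3 ?v1" "b3 \<in> Mod v3 ?v1 v2" and
      a: "a1 = ?t * b1 + fls_const k1 * ?v1 + fls_const l1 * (v2 * v3)"
        "a2 = ?t * b2 + fls_const k2 * v2 + fls_const l2 * (v3 * ?v1)"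
        "a3 = ?t * b3 + fls_const k3 * v3 + fls_const l3 * (?v1 * v2)"
      using w unfolding wa R0_def mem_Times_iff fst_conv snd_conv by (metis Mod_divide_linear)
    have b0: "(b1, b2, b3) \<in> R0" using b by (simp add: R0_def)
    have "sm (inverse ?t) (sm ?t (b1, b2, b3)) = (b1, b2, b3)" using nz by (simp only: sm_sm) simp
    then have "sm ?t (b1, b2, b3) \<in> ?S" using b0 R0_ez[OF b0] by (simp only: mem_Collect_eq simp_thms)
    then have "sm ?t (b1, b2, b3) + sm (fls_const k1) (?v1, 0, 0) + sm (fls_const l1) (v2 * v3, 0, 0)
      + sm (fls_const k2) (0, v2, 0) + sm (fls_const l2) (0, v3 * ?v1, 0)
      + sm (fls_const k3) (0, 0, v3) + sm (fls_const l3) (0, 0, ?v1 * v2) \<in> cv.vs.span (?S \<union> ?G)"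
      by (intro cv.vs.span_add cv.vs.span_scale; intro cv.vs.span_base) blast+
    then show "w \<in> cv.vs.span (?S \<union> ?G)" unfolding wa a by simp
  qed
  ultimately show ?thesis unfolding mults_def cv.fincodim_def mem_Collect_eq
    by (intro exI[of _ ?G]) simp
qed

lemma mults_ez: "ez f \<in> mults R0" and mults_y: "y \<in> mults R0"
  by (auto intro!: multsI intro: R0_ez R0_y simp del: sm_Pair)

text \<open>Over the complex numbers a nonconstant polynomial splits off a linear factor, and
  partial multipliers are closed under products.\<close>

lemma inverse_ez_mults: "ez f \<noteq> 0 \<Longrightarrow> inverse (ez f) \<in> mults R0"
proof (induction "degree f" arbitrary: f rule: less_induct)
  case less
  show ?case
  proof (cases "degree f = 0")
    case True
    then obtain k where f: "f = [:k:]" by (rule degree_eq_zeroE)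
    have "inverse (ez f) = ez [:inverse k:]" by (simp add: f fls_inverse_const)
    then show ?thesis by (simp only: mults_ez)
  next
    case False
    then obtain c where "poly f c = 0"
      using fundamental_theorem_of_algebra[of f] by (auto simp: constant_degree)
    then obtain g where f: "f = [:-c, 1:] * g" by (metis poly_eq_0_iff_dvd dvdE)
    have nz: "ez [:-c, 1:] \<noteq> 0" "ez g \<noteq> 0" using less.prems unfolding f fls.pev_mult by auto
    then have "g \<noteq> 0" by auto
    then have "degree g < degree f" unfolding f by (subst degree_mult_eq) auto
    then have "inverse (ez g) \<in> mults R0" using less.hyps nz by blast
    then have "inverse (ez [:-c, 1:]) * inverse (ez g) \<in> mults R0"
      using inverse_linear_mults nz subspace_R0 by (intro mults_mult)
    then show ?thesis unfolding f fls.pev_mult by (simp add: mult.commute)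
  qed
qed

lemma QF_subset_mults: "QF \<subseteq> mults R0"
proof
  fix q assume "q \<in> QF"
  then obtain f g h where "ez f \<noteq> 0" and q: "q = (ez g + ez h * y) * inverse (ez f)"
    unfolding QF_def by (auto simp: divide_inverse)
  then show "q \<in> mults R0"
    unfolding q by (intro mults_mult mults_add subspace_R0 mults_ez mults_y inverse_ez_mults)
qed

section \<open>Maps commuting with brackets are multiplications\<close>

text \<open>The vectors (z - e1)^k d span an infinite-dimensional subspace of \<open>R0\<close>,
  which \<open>H\<close> must meet outside 0. A nonzero series as factor is enough for the later
  test of collinearity.\<close>

lemma exists_multiple_in_fincodim:
  assumes d: "d \<in> R0" "d \<noteq> 0" and H: "cv.vs.subspace H" "cv.fincodim H R0"
  obtains f where "f \<noteq> 0" "sm f d \<in> H"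
proof -
  obtain \<pi> :: "vec3 \<Rightarrow> complex fls" where \<pi>: "\<pi> d \<noteq> 0"
    "\<And>v w. \<pi> (v + w) = \<pi> v + \<pi> w" "\<And>q w. \<pi> (sm q w) = q * \<pi> w"
  proof -
    obtain a b c where dd: "d = (a, b, c)" by (cases d)
    consider "a \<noteq> 0" | "b \<noteq> 0" | "c \<noteq> 0" using d(2) by (auto simp: dd zero_prod_def)
    then show ?thesis
      using that[of fst] that[of "\<lambda>w. fst (snd w)"] that[of "\<lambda>w. snd (snd w)"]
      by cases (simp_all add: dd sm_def)
  qed
  \<comment> \<open>Even powers are taken because X^2 = z - e1 lies in C[z], which acts on
    \<open>R0\<close>.\<close>
  define x where "x k = sm (fls_X ^ (2 * k)) d" for k :: nat
  \<comment> \<open>Coefficient functionals dual to the vectors \<open>x k\<close>: \<pi> reads off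
    a coordinate in which \<open>d\<close> is nonzero, and division by \<pi> \<open>d\<close> leaves
    the power of X.\<close>
  define \<psi> where "\<psi> k w = fls_nth (\<pi> w / \<pi> d) (int (2 * k))" for k :: nat and w
  have \<psi>x: "\<psi> k (x j) = (if j = k then 1 else 0)" for j k
    using \<pi>(1) by (auto simp: \<psi>_def x_def \<pi>(3) fls_X_power_nth)
  have \<psi>_lin: "cv.vs.subspace {w. \<psi> k w = 0}" for k
  proof -
    have "\<pi> 0 = 0" using \<pi>(3)[of 0 0] by simp
    then show ?thesis
      by (simp add: cv.vs.subspace_def \<psi>_def \<pi>(2,3) add_divide_distrib flip: times_divide_eq_right)
  qed
  have "inj x"
    by (rule injI) (metis \<psi>x zero_neq_one)
  have indep: "cv.vs.independent (range x)"
    unfolding cv.vs.dependent_def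
  proof
    assume "\<exists>a\<in>range x. a \<in> cv.vs.span (range x - {a})"
    then obtain k where "x k \<in> cv.vs.span (range x - {x k})" by blast
    moreover have "cv.vs.span (range x - {x k}) \<subseteq> {w. \<psi> k w = 0}"
      using \<psi>_lin by (intro cv.vs.span_minimal) (auto simp: \<psi>x)
    ultimately have "\<psi> k (x k) = 0" by blast
    then show False by (simp add: \<psi>x)
  qed
  let ?U = "cv.vs.span (range x)"
  have "x k \<in> R0" for k
  proof -
    have "fls_X ^ (2 * k) = ez ([:-e1, 1:] ^ k)"
      by (simp add: power_mult square_eq fls.pev_power)
    then show ?thesis unfolding x_def using R0_ez[OF d(1)] by simp
  qed
  then have U: "?U \<subseteq> R0" by (intro cv.vs.span_minimal subspace_R0) auto
  have fc: "cv.fincodim (?U \<inter> H) ?U"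
    using H U by (intro cv.fincodim_Int[of _ R0]) auto
  \<comment> \<open>A zero intersection would give the span of an infinite independent family a
    finite spanning set.\<close>
  have "\<not> ?U \<inter> H \<subseteq> {0}"
  proof
    assume "?U \<inter> H \<subseteq> {0}"
    then have "cv.fincodim {0} ?U" using fc cv.fincodim_mono by blast
    then obtain G where "finite G" "?U \<subseteq> cv.vs.span ({0} \<union> G)"
      unfolding cv.fincodim_def by blast
    then have "finite (range x)"
      using cv.vs.independent_span_bound[OF _ indep, of "{0} \<union> G"] cv.vs.span_superset by blast
    then show False using \<open>inj x\<close> finite_imageD by blast
  qed
  then obtain u where u: "u \<in> ?U" "u \<in> H" "u \<noteq> 0" by blast
  have "cv.vs.subspace {sm f d | f. True}"
  proof (rule cv.vs.subspaceI)
    show "0 \<in> {sm f d | f. True}" using sm_0[of d] by (metis (mono_tags) mem_Collect_eq)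
    show "v + w \<in> {sm f d | f. True}" if vw: "v \<in> {sm f d | f. True}" "w \<in> {sm f d | f. True}" for v w
    proof -
      obtain f g where "v = sm f d" "w = sm g d" using vw by blast
      then have "v + w = sm (f + g) d" by (simp add: sm_add_left)
      then show ?thesis by blast
    qed
    show "sm (fls_const c) w \<in> {sm f d | f. True}" if w: "w \<in> {sm f d | f. True}" for c w
    proof -
      obtain f where "w = sm f d" using w by blast
      then have "sm (fls_const c) w = sm (fls_const c * f) d" by (simp add: sm_sm)
      then show ?thesis by blast
    qed
  qed
  then have "?U \<subseteq> {sm f d | f. True}"
    by (intro cv.vs.span_minimal) (auto simp: x_def)
  then obtain f where "u = sm f d" using u by blast
  then show ?thesis using u that[of f] by (auto simp: sm_eq_0_iff)
qed

text \<open>The first two generators of the Lie algebra point in different coordinate directions,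
  and nonzero multiples of them keep a nonzero cross product.\<close>

lemma exists_noncollinear:
  assumes "cv.vs.subspace H" "cv.fincodim H R0"
  obtains p r where "p \<in> H" "r \<in> H" "cross p r \<noteq> 0"
proof -
  obtain f where f: "f \<noteq> 0" "sm f (fls_X, 0, 0) \<in> H"
    using exists_multiple_in_fincodim[OF R0_v(1) _ assms] by (auto simp: zero_prod_def)
  obtain g where g: "g \<noteq> 0" "sm g (0, v2, 0) \<in> H"
    using exists_multiple_in_fincodim[OF R0_v(2) _ assms] v_nz by (auto simp: zero_prod_def)
  show ?thesis using that[OF f(2) g(2)] f g v_nz by (simp add: zero_prod_def)
qed

lemma multiplier_exists:
  assumes H: "H \<subseteq> R0" "cv.vs.subspace H" "cv.fincodim H R0"
    and h: "\<And>p. p \<in> H \<Longrightarrow> h p \<in> R0"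
    and hh: "\<And>p q. p \<in> H \<Longrightarrow> q \<in> H \<Longrightarrow> cross (h p) q = cross p (h q)"
  obtains a where "a \<in> QF" "\<And>p. p \<in> H \<Longrightarrow> h p = sm a p"
proof -
  have parallel: "cross (h p) p = 0" if "p \<in> H" for p
  proof -
    have "cross (h p) p = sm (- 1) (cross (h p) p)" using hh[OF that that] cross_anticomm by metis
    \<comment> \<open>The cross product equals its own negative, and 2 is nonzero in the field of
      series.\<close>
    then have "sm 2 (cross (h p) p) = 0"
      using sm_add_left[of 1 1] sm_add_left[of 1 "- 1"] by (metis add.right_inverse one_add_one sm_0 sm_1)
    then show ?thesis by (simp add: sm_eq_0_iff)
  qed
  obtain p r where pr: "p \<in> H" "r \<in> H" "cross p r \<noteq> 0"
    using exists_noncollinear H by blast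
  then have nz: "p \<noteq> 0" "r \<noteq> 0" by (auto simp: cross_def zero_prod_def)
  obtain a where a: "h p = sm a p" using cross_eq_0_imp_sm[OF parallel] pr nz by metis
  obtain b where b: "h r = sm b r" using cross_eq_0_imp_sm[OF parallel] pr nz by metis
  have "sm a (cross p r) = sm b (cross p r)"
    using hh[OF pr(1,2)] by (simp add: a b cross_sm_left cross_sm_right)
  then have "sm (a - b) (cross p r) = 0"
    by (simp add: sm_def prod_eq_iff algebra_simps)
  then have ab: "a = b" using pr by (simp add: sm_eq_0_iff)
  have "h s = sm a s" if s: "s \<in> H" for s
  proof -
    \<comment> \<open>\<open>t\<close> is the deviation of \<open>h s\<close> from the expected
      value. It has zero cross product with both \<open>p\<close> and \<open>r\<close>, which are
      not parallel to each other, so it vanishes.\<close>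
    define t where "t = h s + sm (- a) s"
    have lin: "cross t q = cross (h s) q + sm (- a) (cross s q)" for q
      unfolding t_def by (simp add: cross_def sm_def prod_eq_iff algebra_simps)
    have "cross t q = 0" if q: "q \<in> {p, r}" for q
    proof -
      have "h q = sm a q" "q \<in> H" using q a b ab pr by auto
      then have "cross t q = sm a (cross s q) + sm (- a) (cross s q)"
        unfolding lin using hh[OF s, of q] by (simp add: cross_sm_right)
      then show ?thesis by (simp add: sm_add_left[symmetric])
    qed
    then have t: "cross t p = 0" "cross t r = 0" by simp_all
    obtain k where k: "t = sm k p" using cross_eq_0_imp_sm[OF t(1) nz(1)] .
    then have "k = 0" using t(2) pr(3) by (simp add: cross_sm_left sm_eq_0_iff)
    then have "t = 0" using k by simp
    then show ?thesis unfolding t_def by (simp add: sm_def prod_eq_iff)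
  qed
  moreover have "a \<in> QF"
    using multiplier_in_QF[of p a] pr nz a H h by (metis subsetD)
  ultimately show ?thesis using that by blast
qed

section \<open>Representatives of the function field\<close>

definition fracs_of :: "complex fls \<Rightarrow> (Eel \<times> Eel) set" where
  "fracs_of q = {(fib a, fib b) | a b. a \<in> RE \<and> b \<in> RE \<and> b \<noteq> 0 \<and> a = q * b}"

lemma fib_0: "Ecl e1 e2 e3 0 = fib 0"
  by (simp add: Ecl_eq_fib)

lemma frac_class_fib:
  assumes "a \<in> RE" "b \<in> RE" "b \<noteq> 0"
  shows "frac_class e1 e2 e3 (fib a, fib b) = fracs_of (a / b)"
proof -
  have "Emul e1 e2 e3 (fib a) (fib d) = Emul e1 e2 e3 (fib b) (fib c) \<longleftrightarrow> c = a / b * d"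
    if "c \<in> RE" "d \<in> RE" for c d
    using assms that by (simp add: Emul_fib fib_eq_iff RE_mult field_simps) (metis)
  then show ?thesis
    by (auto simp: frac_class_def frac_pairs_def fracs_of_def Eset_eq fib_0 fib_eq_iff)
qed

lemma Qreps_imp:
  "(A, B) \<in> Qreps e1 e2 e3 \<Longrightarrow> \<exists>a b. a \<in> RE \<and> b \<in> RE \<and> b \<noteq> 0 \<and> A = fib a \<and> B = fib b \<and> a / b \<in> QF"
proof (induction rule: Qreps.induct)
  case (Q_const k)
  show ?case using QF_ez[of "[:k:]"]
    by (intro exI[of _ "fls_const k"] exI[of _ 1]) (simp add: Ecl_eq_fib RE_closed)
next
  case Q_z
  show ?case using QF_ez[of "[:0, 1:]"]
    by (intro exI[of _ z] exI[of _ 1])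
      (simp add: zel_def Ecl_eq_fib RE_closed RE_z theta_add theta_mult z_def power2_eq_square)
next
  case Q_y
  show ?case using QF_ez_y[of 0 1]
    by (intro exI[of _ y] exI[of _ 1])
      (simp add: yel_def Ecl_eq_fib RE_closed RE_y theta_mult y_def)
next
  case (Q_add A B C D)
  then obtain a b c d where *: "a \<in> RE" "b \<in> RE" "b \<noteq> 0" "A = fib a" "B = fib b" "a / b \<in> QF"
    "c \<in> RE" "d \<in> RE" "d \<noteq> 0" "C = fib c" "D = fib d" "c / d \<in> QF" by blast
  then have "(a * d + b * c) / (b * d) \<in> QF"
    using QF_add[of "a / b" "c / d"] by (simp add: field_simps)
  then show ?case using *
    by (intro exI[of _ "a * d + b * c"] exI[of _ "b * d"]) (simp add: Emul_fib Eadd_fib RE_closed)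
next
  case (Q_mul A B C D)
  then obtain a b c d where *: "a \<in> RE" "b \<in> RE" "b \<noteq> 0" "A = fib a" "B = fib b" "a / b \<in> QF"
    "c \<in> RE" "d \<in> RE" "d \<noteq> 0" "C = fib c" "D = fib d" "c / d \<in> QF" by blast
  then have "(a * c) / (b * d) \<in> QF"
    using QF_mult[of "a / b" "c / d"] by (simp add: field_simps)
  then show ?case using *
    by (intro exI[of _ "a * c"] exI[of _ "b * d"]) (simp add: Emul_fib RE_closed)
next
  case (Q_neg A B)
  then obtain a b where *: "a \<in> RE" "b \<in> RE" "b \<noteq> 0" "A = fib a" "B = fib b" "a / b \<in> QF" by blast
  then show ?case using QF_uminus[of "a / b"] RE_diff[of 0 a] RE_0
    by (intro exI[of _ "- a"] exI[of _ b]) (simp add: fib_0 Esub_fib)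
next
  case (Q_inv A B)
  then obtain a b where *: "a \<in> RE" "b \<in> RE" "b \<noteq> 0" "A = fib a" "B = fib b" "a / b \<in> QF" by blast
  moreover have "a \<noteq> 0" using * Q_inv.hyps by (auto simp: fib_0)
  ultimately show ?case using QF_inverse[of "a / b"]
    by (intro exI[of _ b] exI[of _ a]) simp
qed

text \<open>Serves the inclusion opposite to \<open>Qreps_imp\<close>: this set contains the
  constants, z and y and is closed under sums, products and inverses of nonzero elements, which
  forces all of \<open>QF\<close> into it.\<close>

definition represented :: "complex fls set" where
  "represented = {q. \<exists>a b. a \<in> RE \<and> b \<in> RE \<and> b \<noteq> 0 \<and> (fib a, fib b) \<in> Qreps e1 e2 e3 \<and> q = a / b}"

lemma represented_add: assumes "p \<in> represented" "q \<in> represented" shows "p + q \<in> represented"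
proof -
  obtain a b c d where *: "a \<in> RE" "b \<in> RE" "b \<noteq> 0" "(fib a, fib b) \<in> Qreps e1 e2 e3" "p = a / b"
    "c \<in> RE" "d \<in> RE" "d \<noteq> 0" "(fib c, fib d) \<in> Qreps e1 e2 e3" "q = c / d"
    using assms unfolding represented_def by blast
  have "(fib (a * d + b * c), fib (b * d)) \<in> Qreps e1 e2 e3"
    using Qreps.Q_add[OF *(4,9)] * by (simp add: Emul_fib Eadd_fib RE_closed)
  then show ?thesis using * unfolding represented_def mem_Collect_eq
    by (intro exI[of _ "a * d + b * c"] exI[of _ "b * d"]) (simp add: RE_closed field_simps)
qed

lemma represented_mult: assumes "p \<in> represented" "q \<in> represented" shows "p * q \<in> represented"
proof -
  obtain a b c d where *: "a \<in> RE" "b \<in> RE" "b \<noteq> 0" "(fib a, fib b) \<in> Qreps e1 e2 e3" "p = a / b"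
    "c \<in> RE" "d \<in> RE" "d \<noteq> 0" "(fib c, fib d) \<in> Qreps e1 e2 e3" "q = c / d"
    using assms unfolding represented_def by blast
  have "(fib (a * c), fib (b * d)) \<in> Qreps e1 e2 e3"
    using Qreps.Q_mul[OF *(4,9)] * by (simp add: Emul_fib RE_closed)
  then show ?thesis using * unfolding represented_def mem_Collect_eq
    by (intro exI[of _ "a * c"] exI[of _ "b * d"]) (simp add: RE_closed field_simps)
qed

lemma represented_inverse: assumes "p \<in> represented" "p \<noteq> 0" shows "inverse p \<in> represented"
proof -
  obtain a b where *: "a \<in> RE" "b \<in> RE" "b \<noteq> 0" "(fib a, fib b) \<in> Qreps e1 e2 e3" "p = a / b"
    using assms unfolding represented_def by blast
  moreover have "(fib b, fib a) \<in> Qreps e1 e2 e3"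
    by (rule Qreps.Q_inv) (use * assms(2) in \<open>auto simp: fib_0 fib_eq_iff\<close>)
  ultimately show ?thesis using assms(2) unfolding represented_def mem_Collect_eq
    by (intro exI[of _ b] exI[of _ a]) simp
qed

lemma represented_ez: "ez f \<in> represented"
proof (induction f)
  have c: "fls_const k \<in> represented" for k
    using Qreps.Q_const[of e1 e2 e3 k] unfolding represented_def mem_Collect_eq
    by (intro exI[of _ "fls_const k"] exI[of _ 1]) (simp add: Ecl_eq_fib RE_closed)
  have zQ: "z \<in> represented"
    using Qreps.Q_z[of e1 e2 e3] unfolding represented_def mem_Collect_eq
    by (intro exI[of _ z] exI[of _ 1])
      (simp add: zel_def Ecl_eq_fib RE_closed RE_z theta_add theta_mult z_def power2_eq_square)
  case 0
  show ?case using c[of 0] by simp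
  case (pCons k f)
  then show ?case using c zQ by (simp add: represented_add represented_mult)
qed

lemma QF_subset_represented: "QF \<subseteq> represented"
proof
  have y: "y \<in> represented"
    using Qreps.Q_y[of e1 e2 e3] unfolding represented_def mem_Collect_eq
    by (intro exI[of _ y] exI[of _ 1])
      (simp add: yel_def Ecl_eq_fib RE_closed RE_y theta_mult y_def)
  fix q assume "q \<in> QF"
  then obtain f g h where "ez f \<noteq> 0" and q: "q = (ez g + ez h * y) * inverse (ez f)"
    unfolding QF_def by (auto simp: divide_inverse)
  then show "q \<in> represented"
    unfolding q by (intro represented_mult represented_add represented_ez y represented_inverse)
qed

lemma QF_rep: "q \<in> QF \<Longrightarrow> \<exists>a b. a \<in> RE \<and> b \<in> RE \<and> b \<noteq> 0 \<and> (fib a, fib b) \<in> Qreps e1 e2 e3 \<and> q = a / b"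
  using QF_subset_represented by (auto simp: represented_def)

lemma Qcarrier_eq: "Qcarrier e1 e2 e3 = fracs_of ` QF"
proof
  show "Qcarrier e1 e2 e3 \<subseteq> fracs_of ` QF"
    unfolding Qcarrier_def using Qreps_imp by (fastforce simp: frac_class_fib)
  show "fracs_of ` QF \<subseteq> Qcarrier e1 e2 e3"
  proof
    fix X assume "X \<in> fracs_of ` QF"
    then obtain q where "q \<in> QF" "X = fracs_of q" by blast
    moreover then obtain a b where "a \<in> RE" "b \<in> RE" "b \<noteq> 0" "(fib a, fib b) \<in> Qreps e1 e2 e3" "q = a / b"
      using QF_rep by blast
    ultimately show "X \<in> Qcarrier e1 e2 e3"
      unfolding Qcarrier_def by (metis frac_class_fib imageI)
  qed
qed

lemma fracs_of_E:
  assumes "P \<in> fracs_of q"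
  obtains a b where "P = (fib a, fib b)" "a \<in> RE" "b \<in> RE" "b \<noteq> 0" "q = a / b"
proof -
  obtain a b where "P = (fib a, fib b)" "a \<in> RE" "b \<in> RE" "b \<noteq> 0" "a = q * b"
    using assms unfolding fracs_of_def by blast
  then show ?thesis by (intro that[of a b]) simp_all
qed

lemma fracs_of_nonempty:
  assumes "q \<in> QF"
  shows "fracs_of q \<noteq> {}"
proof -
  obtain a b where "a \<in> RE" "b \<in> RE" "b \<noteq> 0" "q = a / b"
    using QF_rep[OF assms] by blast
  moreover from this have "a = q * b" by simp
  ultimately have "(fib a, fib b) \<in> fracs_of q" unfolding fracs_of_def by blast
  then show ?thesis by blast
qed

lemma inj_on_fracs_of: "inj_on fracs_of QF"
proof (rule inj_onI)
  fix q r assume "q \<in> QF" "fracs_of q = fracs_of r"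
  then obtain P where "P \<in> fracs_of q" "P \<in> fracs_of r" using fracs_of_nonempty by blast
  then show "q = r" by (elim fracs_of_E) (auto simp: fib_eq_iff)
qed

lemma Q_add_fracs_of:
  assumes "q \<in> QF" "r \<in> QF"
  shows "Q_add e1 e2 e3 (fracs_of q) (fracs_of r) = fracs_of (q + r)"
  unfolding Q_add_def
proof (intro UNION_const2 fracs_of_nonempty assms)
  fix A B C D assume "(A, B) \<in> fracs_of q" "(C, D) \<in> fracs_of r"
  then obtain a b c d where *: "A = fib a" "B = fib b" "a \<in> RE" "b \<in> RE" "b \<noteq> 0" "q = a / b"
    "C = fib c" "D = fib d" "c \<in> RE" "d \<in> RE" "d \<noteq> 0" "r = c / d"
    by (elim fracs_of_E) blast
  then have "(a * d + b * c) / (b * d) = q + r" by (simp add: field_simps)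
  then show "frac_class e1 e2 e3 (Eadd e1 e2 e3 (Emul e1 e2 e3 A D) (Emul e1 e2 e3 B C), Emul e1 e2 e3 B D) = fracs_of (q + r)"
    using * by (simp add: Emul_fib Eadd_fib RE_closed frac_class_fib)
qed

lemma Q_mul_fracs_of:
  assumes "q \<in> QF" "r \<in> QF"
  shows "Q_mul e1 e2 e3 (fracs_of q) (fracs_of r) = fracs_of (q * r)"
  unfolding Q_mul_def
proof (intro UNION_const2 fracs_of_nonempty assms)
  fix A B C D assume "(A, B) \<in> fracs_of q" "(C, D) \<in> fracs_of r"
  then obtain a b c d where *: "A = fib a" "B = fib b" "a \<in> RE" "b \<in> RE" "b \<noteq> 0" "q = a / b"
    "C = fib c" "D = fib d" "c \<in> RE" "d \<in> RE" "d \<noteq> 0" "r = c / d"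
    by (elim fracs_of_E) blast
  then show "frac_class e1 e2 e3 (Emul e1 e2 e3 A C, Emul e1 e2 e3 B D) = fracs_of (q * r)"
    by (simp add: Emul_fib RE_closed frac_class_fib)
qed

lemma Q_smul_fracs_of:
  assumes "q \<in> QF"
  shows "Q_smul e1 e2 e3 k (fracs_of q) = fracs_of (fls_const k * q)"
  unfolding Q_smul_def
proof (intro UNION_const1 fracs_of_nonempty assms)
  fix A B assume "(A, B) \<in> fracs_of q"
  then obtain a b where *: "A = fib a" "B = fib b" "a \<in> RE" "b \<in> RE" "b \<noteq> 0" "q = a / b"
    by (elim fracs_of_E) blast
  then show "frac_class e1 e2 e3 (Escale e1 e2 e3 k A, B) = fracs_of (fls_const k * q)"
    by (simp add: Escale_fib RE_closed frac_class_fib)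
qed

section \<open>Transport of Lie-theoretic notions\<close>

text \<open>One notation covers both Lie algebras: \<open>W\<close> is \<open>R0\<close> for the
  ambient algebra and the preimage of L for the subalgebra.\<close>

definition lie_on :: "vec3 set \<Rightarrow> tens lie_alg" where
  "lie_on W = (Rlie e1 e2 e3)\<lparr>lcarrier := tau ` W\<rparr>"

lemma lie_on_simps [simp]:
  "lcarrier (lie_on W) = tau ` W" "ladd (lie_on W) = tadd e1 e2 e3"
  "lsmul (lie_on W) = tsmul e1 e2 e3" "lbr (lie_on W) = tbr e1 e2 e3"
  "lzero (lie_on W) = tau 0"
  by (simp_all add: lie_on_def Rlie_def tau_zero)

lemma Rlie_eq: "Rlie e1 e2 e3 = lie_on R0"
  by (simp add: lie_on_def Rlie_def Rgen_eq)

definition bracket_subspace :: "vec3 set \<Rightarrow> bool" where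
  "bracket_subspace S \<longleftrightarrow> cv.vs.subspace S \<and> (\<forall>v\<in>S. \<forall>w\<in>S. cross v w \<in> S)"

lemma subspace_RE3: "cv.vs.subspace RE3"
proof (rule cv.vs.subspaceI)
  show "0 \<in> RE3" by (simp add: RE3_def RE_0 zero_prod_def)
qed (intro RE3_closed RE_const; assumption)+

lemma tau_in_image_iff: "w \<in> RE3 \<Longrightarrow> S \<subseteq> RE3 \<Longrightarrow> tau w \<in> tau ` S \<longleftrightarrow> w \<in> S"
  by (rule inj_on_image_mem_iff[OF inj_on_tau])

lemma tau_image_subset_iff: "W \<subseteq> RE3 \<Longrightarrow> S \<subseteq> RE3 \<Longrightarrow> tau ` W \<subseteq> tau ` S \<longleftrightarrow> W \<subseteq> S"
  using tau_in_image_iff[of _ S] by blast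

lemma tau_eq_iff: "v \<in> RE3 \<Longrightarrow> w \<in> RE3 \<Longrightarrow> tau v = tau w \<longleftrightarrow> v = w"
  by (rule inj_on_eq_iff[OF inj_on_tau])

lemma span_subset_RE3: "X \<subseteq> RE3 \<Longrightarrow> cv.vs.span X \<subseteq> RE3"
  by (rule cv.vs.span_minimal[OF _ subspace_RE3])

lemma lin_hull_tau:
  assumes X: "X \<subseteq> RE3"
  shows "lin_hull (lie_on W) (tau ` X) = tau ` cv.vs.span X"
proof
  let ?S = "cv.vs.span X"
  have S: "w \<in> RE3" if "w \<in> ?S" for w using span_subset_RE3[OF X] that by blast
  show "lin_hull (lie_on W) (tau ` X) \<subseteq> tau ` ?S"
  proof
    fix x assume "x \<in> lin_hull (lie_on W) (tau ` X)"
    then show "x \<in> tau ` ?S"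
    proof (induction rule: lin_hull.induct)
      case lh_zero
      then show ?case by (simp add: cv.vs.span_zero)
    next
      case (lh_base x)
      then show ?case using cv.vs.span_superset by blast
    next
      case (lh_add x x')
      then obtain v w where "x = tau v" "x' = tau w" "v \<in> ?S" "w \<in> ?S" by blast
      then show ?case by (simp add: tau_add S cv.vs.span_add)
    next
      case (lh_smul x k)
      then obtain v where "x = tau v" "v \<in> ?S" by blast
      then show ?case by (simp add: tau_smul S cv.vs.span_scale)
    qed
  qed
  let ?T = "{w \<in> RE3. tau w \<in> lin_hull (lie_on W) (tau ` X)}"
  have "cv.vs.subspace ?T"
  proof (rule cv.vs.subspaceI)
    show "0 \<in> ?T" using lh_zero[of "lie_on W"] subspace_RE3 by (simp add: cv.vs.subspace_0)
    show "v + w \<in> ?T" if "v \<in> ?T" "w \<in> ?T" for v w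
      using that lh_add[of "tau v" "lie_on W" "tau ` X" "tau w"] by (simp add: tau_add RE3_add)
    show "sm (fls_const k) w \<in> ?T" if "w \<in> ?T" for k w
      using that lh_smul[of "tau w" "lie_on W" "tau ` X" k] by (simp add: tau_smul RE3_sm RE_const)
  qed
  moreover have "X \<subseteq> ?T" using X by (auto intro: lh_base)
  ultimately have "?S \<subseteq> ?T" by (simp add: cv.vs.span_minimal)
  then show "tau ` ?S \<subseteq> lin_hull (lie_on W) (tau ` X)" by blast
qed

lemma fin_codim_tau:
  assumes "S \<subseteq> RE3" "W \<subseteq> RE3"
  shows "fin_codim (lie_on W) (tau ` S) \<longleftrightarrow> cv.fincodim S W"
proof -
  have *: "lcarrier (lie_on W) \<subseteq> lin_hull (lie_on W) (tau ` S \<union> tau ` G) \<longleftrightarrow> W \<subseteq> cv.vs.span (S \<union> G)"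
    if "G \<subseteq> W" for G
  proof -
    have "S \<union> G \<subseteq> RE3" using that assms by blast
    then show ?thesis
      using tau_image_subset_iff[OF assms(2) span_subset_RE3, of "S \<union> G"]
      by (simp add: lin_hull_tau flip: image_Un)
  qed
  show ?thesis
  proof
    assume "fin_codim (lie_on W) (tau ` S)"
    then obtain F where F: "finite F" "F \<subseteq> tau ` W"
      "lcarrier (lie_on W) \<subseteq> lin_hull (lie_on W) (tau ` S \<union> F)"
      unfolding fin_codim_def by auto
    obtain G where G: "G \<subseteq> W" "finite G" "F = tau ` G"
      using finite_subset_image[OF F(1,2)] by blast
    then have "W \<subseteq> cv.vs.span (S \<union> G)" using * F(3) by simp
    then show "cv.fincodim S W" unfolding cv.fincodim_def using G by blast
  next
    assume "cv.fincodim S W"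
    then obtain G where G: "finite G" "G \<subseteq> W" "W \<subseteq> cv.vs.span (S \<union> G)"
      unfolding cv.fincodim_def by blast
    then have "lcarrier (lie_on W) \<subseteq> lin_hull (lie_on W) (tau ` S \<union> tau ` G)" using * by simp
    then show "fin_codim (lie_on W) (tau ` S)"
      unfolding fin_codim_def using G by (intro exI[of _ "tau ` G"]) auto
  qed
qed

lemma lie_subalg_tau:
  assumes "S \<subseteq> RE3" "W \<subseteq> RE3"
  shows "lie_subalg (lie_on W) (tau ` S) \<longleftrightarrow> S \<subseteq> W \<and> bracket_subspace S"
proof -
  have S: "w \<in> RE3" if "w \<in> S" for w using that assms by blast
  have "0 \<in> RE3" using subspace_RE3 by (rule cv.vs.subspace_0)
  moreover have "v + w \<in> RE3" "cross v w \<in> RE3" "sm (fls_const k) w \<in> RE3"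
    if "v \<in> RE3" "w \<in> RE3" for v w k using that by (auto intro: RE3_closed RE_const)
  ultimately show ?thesis
    using assms tau_image_subset_iff[OF assms]
    unfolding lie_subalg_def bracket_subspace_def cv.vs.subspace_def
    by (simp add: tau_add tau_smul tau_cross S tau_in_image_iff conj_ac)
qed

end

section \<open>Admissible pairs on the subalgebra as partial multiplications\<close>

locale curve_subalgebra = curve_series +
  fixes L0 :: "vec3 set"
  assumes L0_R0: "L0 \<subseteq> R0" and L0_bracket: "bracket_subspace L0"
    and L0_fincodim: "cv.fincodim L0 R0"
begin

abbreviation "M \<equiv> lie_on L0"

lemma L0_RE3: "L0 \<subseteq> RE3"
  using L0_R0 R0_subset_RE3 by blast

lemma subspace_L0: "cv.vs.subspace L0"
  using L0_bracket by (simp add: bracket_subspace_def)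

text \<open>The possible domains of admissible pairs, read in series. Codimension is relative to L;
  \<open>cofinite_subD\<close> passes to the ambient algebra, where the multiplier lemmas
  apply.\<close>

definition cofinite_sub :: "vec3 set \<Rightarrow> bool" where
  "cofinite_sub S \<longleftrightarrow> S \<subseteq> L0 \<and> bracket_subspace S \<and> cv.fincodim S L0"

lemma cofinite_subD:
  assumes "cofinite_sub S"
  shows "S \<subseteq> L0" "S \<subseteq> RE3" "cv.vs.subspace S" "cv.fincodim S R0"
    "\<And>v w. v \<in> S \<Longrightarrow> w \<in> S \<Longrightarrow> v + w \<in> S" "\<And>k w. w \<in> S \<Longrightarrow> sm (fls_const k) w \<in> S"
    "\<And>v w. v \<in> S \<Longrightarrow> w \<in> S \<Longrightarrow> cross v w \<in> S"
  using assms L0_RE3 cv.fincodim_trans[OF _ L0_fincodim L0_R0]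
  by (auto simp: cofinite_sub_def bracket_subspace_def cv.vs.subspace_def)

lemma cofinite_sub_iff:
  "lie_subalg M H \<and> fin_codim M H \<longleftrightarrow> (\<exists>S. cofinite_sub S \<and> H = tau ` S)"
proof
  assume H: "lie_subalg M H \<and> fin_codim M H"
  then have "H \<subseteq> tau ` L0" by (simp add: lie_subalg_def)
  then obtain S where S: "S \<subseteq> L0" "H = tau ` S" by (auto elim: subset_imageE)
  then have "S \<subseteq> RE3" using L0_RE3 by blast
  then show "\<exists>S. cofinite_sub S \<and> H = tau ` S"
    using H S L0_RE3 unfolding cofinite_sub_def
    by (intro exI[of _ S]) (simp add: lie_subalg_tau fin_codim_tau)
next
  assume "\<exists>S. cofinite_sub S \<and> H = tau ` S"
  then obtain S where S: "cofinite_sub S" "H = tau ` S" by blast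
  then have "S \<subseteq> RE3" using cofinite_subD by blast
  then show "lie_subalg M H \<and> fin_codim M H"
    using S L0_RE3 by (simp add: cofinite_sub_def lie_subalg_tau fin_codim_tau)
qed

text \<open>Closure under the bracket comes from q [v, w] = [q v, w]: with q v in \<open>N\<close>
  and w in \<open>S\<close>, the inclusion of \<open>S\<close> in \<open>N\<close> puts the bracket
  into \<open>N\<close>. This yields the domain of a composite.\<close>

lemma cofinite_sub_mult_vimage:
  assumes "cofinite_sub S" "cofinite_sub N" "S \<subseteq> N" "\<And>w. w \<in> S \<Longrightarrow> sm q w \<in> L0"
  shows "cofinite_sub {w \<in> S. sm q w \<in> N}"
proof -
  note S = cofinite_subD[OF assms(1)] and N = cofinite_subD[OF assms(2)]
  have "cv.fincodim {w \<in> S. sm q w \<in> N} S"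
    using assms S N by (intro fincodim_mult_vimage[of N L0]) (auto simp: cofinite_sub_def)
  then have "cv.fincodim {w \<in> S. sm q w \<in> N} L0"
    by (rule cv.fincodim_trans) (use assms(1) in \<open>auto simp: cofinite_sub_def\<close>)
  moreover have "cv.vs.subspace {w \<in> S. sm q w \<in> N}"
    using S N by (intro subspace_mult_vimage)
  moreover have "sm q (cross v w) \<in> N" if "w \<in> S" "sm q v \<in> N" for v w
    using N(7)[OF that(2), of w] that(1) assms(3) by (auto simp: cross_sm_left)
  then have "\<forall>v\<in>{w \<in> S. sm q w \<in> N}. \<forall>w\<in>{w \<in> S. sm q w \<in> N}. cross v w \<in> {w \<in> S. sm q w \<in> N}"
    using S(7) by simp
  moreover have "{w \<in> S. sm q w \<in> N} \<subseteq> L0" using S(1) by blast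
  ultimately show ?thesis
    unfolding cofinite_sub_def bracket_subspace_def by (intro conjI)
qed

lemma cofinite_sub_Int:
  assumes "cofinite_sub S" "cofinite_sub N"
  shows "cofinite_sub (S \<inter> N)"
proof -
  note S = cofinite_subD[OF assms(1)] and N = cofinite_subD[OF assms(2)]
  have "cv.fincodim (S \<inter> N) S"
    using assms S N by (intro cv.fincodim_Int[of N L0]) (auto simp: cofinite_sub_def)
  then have "cv.fincodim (S \<inter> N) L0"
    by (rule cv.fincodim_trans) (use assms(1) in \<open>auto simp: cofinite_sub_def\<close>)
  moreover have "cv.vs.subspace (S \<inter> N)" using S N by (intro cv.vs.subspace_inter)
  moreover have "\<forall>v\<in>S \<inter> N. \<forall>w\<in>S \<inter> N. cross v w \<in> S \<inter> N" using S(7) N(7) by simp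
  moreover have "S \<inter> N \<subseteq> L0" using S(1) by blast
  ultimately show ?thesis
    unfolding cofinite_sub_def bracket_subspace_def by (intro conjI)
qed

lemma cofinite_sub_L0: "cofinite_sub L0"
  using L0_bracket by (simp add: cofinite_sub_def cv.fincodim_refl)

text \<open>Functions are total in HOL, so agreement with a multiplication is demanded on the domain
  only.\<close>

definition acts_as :: "complex fls \<Rightarrow> (tens \<Rightarrow> tens) \<Rightarrow> vec3 set \<Rightarrow> bool" where
  "acts_as q h S \<longleftrightarrow> (\<forall>w\<in>S. sm q w \<in> L0 \<and> h (tau w) = tau (sm q w))"

lemma admissibleI:
  assumes "cofinite_sub S" "acts_as q h S"
  shows "admissible M (h, tau ` S)"
proof -
  note S = cofinite_subD[OF assms(1)]
  have w: "w \<in> RE3" "sm q w \<in> RE3" "sm q w \<in> L0" "h (tau w) = tau (sm q w)" if "w \<in> S" for w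
    using that assms(2) S(2) L0_RE3 unfolding acts_as_def by blast+
  have "lie_subalg M (tau ` S) \<and> fin_codim M (tau ` S)"
    using cofinite_sub_iff assms(1) by blast
  moreover have "tadd e1 e2 e3 (h (tau v)) (h (tau w)) = h (tadd e1 e2 e3 (tau v) (tau w))"
    if "v \<in> S" "w \<in> S" for v w
    using that S(5) by (simp add: tau_add w sm_add_right)
  moreover have "tsmul e1 e2 e3 k (h (tau w)) = h (tsmul e1 e2 e3 k (tau w))" if "w \<in> S" for w k
    using that S(6) by (simp add: tau_smul w sm_sm mult.commute)
  moreover have "h (tbr e1 e2 e3 (tau v) (tau w)) = tbr e1 e2 e3 (h (tau v)) (tau w)"
    "h (tbr e1 e2 e3 (tau v) (tau w)) = tbr e1 e2 e3 (tau v) (h (tau w))"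
    if "v \<in> S" "w \<in> S" for v w
    using that S(7) by (simp_all add: tau_cross w cross_sm_left cross_sm_right)
  ultimately show ?thesis
    unfolding admissible_def by (simp add: w)
qed

lemma admissibleE:
  assumes "admissible M (h, H)"
  obtains S q where "cofinite_sub S" "H = tau ` S" "q \<in> QF" "acts_as q h S"
proof -
  have "lie_subalg M H \<and> fin_codim M H" using assms by (simp add: admissible_def)
  then obtain S where cS: "cofinite_sub S" and H: "H = tau ` S" using cofinite_sub_iff by blast
  note S = cofinite_subD[OF cS]
  have "\<forall>w\<in>S. h (tau w) \<in> tau ` L0"
    using assms unfolding admissible_def H by simp
  then have "\<exists>v. v \<in> L0 \<and> h (tau w) = tau v" if "w \<in> S" for w
    using that by blast
  \<comment> \<open>\<open>k\<close> is \<open>h\<close> read on series. The two expressions for the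
    value of \<open>h\<close> at a bracket give the hypothesis of
    \<open>multiplier_exists\<close>.\<close>
  then obtain k where k: "\<And>w. w \<in> S \<Longrightarrow> k w \<in> L0" "\<And>w. w \<in> S \<Longrightarrow> h (tau w) = tau (k w)"
    by metis
  have "cross (k v) w = cross v (k w)" if vw: "v \<in> S" "w \<in> S" for v w
  proof -
    have RE: "v \<in> RE3" "w \<in> RE3" "k v \<in> RE3" "k w \<in> RE3"
      using k vw S(2) L0_RE3 by blast+
    have "\<forall>x\<in>H. \<forall>y\<in>H. h (tbr e1 e2 e3 x y) = tbr e1 e2 e3 (h x) y
        \<and> h (tbr e1 e2 e3 x y) = tbr e1 e2 e3 x (h y)"
      using assms unfolding admissible_def prod.case lie_on_simps by (elim conjE)
    then have "tbr e1 e2 e3 (h (tau v)) (tau w) = tbr e1 e2 e3 (tau v) (h (tau w))"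
      using vw H by (metis imageI)
    then show ?thesis using RE by (simp add: k vw tau_cross tau_eq_iff RE3_cross)
  qed
  then obtain q where "q \<in> QF" "\<And>w. w \<in> S \<Longrightarrow> k w = sm q w"
    using multiplier_exists[of S k] S k L0_R0 by (metis subset_iff)
  then show ?thesis using that[OF cS H, of q] k unfolding acts_as_def by metis
qed

text \<open>Factors that agree on one nonzero vector are equal, and a domain with two noncollinear
  vectors contains a nonzero one.\<close>

lemma acts_as_unique:
  assumes "cofinite_sub S" "acts_as q h S" "acts_as r h S"
  shows "q = r"
proof -
  note S = cofinite_subD[OF assms(1)]
  obtain p p' where p: "p \<in> S" "p' \<in> S" "cross p p' \<noteq> 0"
    using exists_noncollinear[OF S(3,4)] .
  have "tau (sm q p) = tau (sm r p)" "sm q p \<in> RE3" "sm r p \<in> RE3"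
    using assms p L0_RE3 unfolding acts_as_def by auto
  then have "sm q p = sm r p" by (simp add: tau_eq_iff)
  then have "sm (q - r) p = 0" by (simp add: sm_def prod_eq_iff algebra_simps)
  moreover have "p \<noteq> 0" using p by (auto simp: cross_def zero_prod_def)
  ultimately show ?thesis by (simp add: sm_eq_0_iff)
qed

lemma acts_as_subset: "acts_as q h S \<Longrightarrow> S' \<subseteq> S \<Longrightarrow> acts_as q h S'"
  unfolding acts_as_def by blast

text \<open>Equivalent pairs share a smaller domain on which both factors act, so uniqueness
  applies; pairs with equal factors agree on the intersection of their domains.\<close>

lemma adm_equiv_iff:
  assumes "cofinite_sub S" "acts_as q h S" "cofinite_sub S'" "acts_as q' h' S'"
  shows "adm_equiv M (h, tau ` S) (h', tau ` S') \<longleftrightarrow> q = q'"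
proof
  assume "adm_equiv M (h, tau ` S) (h', tau ` S')"
  then obtain K where K: "lie_subalg M K" "fin_codim M K" "K \<subseteq> tau ` S \<inter> tau ` S'"
    "\<forall>x\<in>K. h x = h' x"
    unfolding adm_equiv_def by auto
  then obtain N where N: "cofinite_sub N" "K = tau ` N" using cofinite_sub_iff by blast
  have "tau ` N \<subseteq> tau ` S" "tau ` N \<subseteq> tau ` S'" using K(3) N(2) by simp_all
  then have "N \<subseteq> S" "N \<subseteq> S'"
    using assms(1,3) N(1) by (simp_all add: tau_image_subset_iff cofinite_subD(2))
  then have "acts_as q h N" "acts_as q' h' N" using assms acts_as_subset by blast+
  moreover have "acts_as q' h N" using calculation(2) K(4) unfolding acts_as_def N(2) by auto
  ultimately show "q = q'" using acts_as_unique N(1) by blast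
next
  assume "q = q'"
  have "cofinite_sub (S \<inter> S')" using assms cofinite_sub_Int by simp
  then have "lie_subalg M (tau ` (S \<inter> S'))" "fin_codim M (tau ` (S \<inter> S'))"
    using cofinite_sub_iff by blast+
  moreover have "\<forall>x\<in>tau ` (S \<inter> S'). h x = h' x"
    using assms(2,4) \<open>q = q'\<close> unfolding acts_as_def by simp
  ultimately show "adm_equiv M (h, tau ` S) (h', tau ` S')"
    unfolding adm_equiv_def prod.case by (intro exI[of _ "tau ` (S \<inter> S')"]) auto
qed

text \<open>By \<open>adm_class_eq\<close> this is an entire equivalence class whenever it is
  nonempty, so the factor is a complete invariant of the class.\<close>

definition pairs_acting_by :: "complex fls \<Rightarrow> ((tens \<Rightarrow> tens) \<times> tens set) set" where
  "pairs_acting_by q = {(h, tau ` S) | h S. cofinite_sub S \<and> acts_as q h S}"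

lemma adm_class_eq:
  assumes "cofinite_sub S" "acts_as q h S"
  shows "adm_class M (h, tau ` S) = pairs_acting_by q"
proof (intro set_eqI iffI)
  fix P assume "P \<in> adm_class M (h, tau ` S)"
  moreover obtain h' H' where P: "P = (h', H')" by (cases P)
  ultimately have adm: "admissible M (h', H')" "adm_equiv M (h, tau ` S) (h', H')"
    by (auto simp: adm_class_def)
  from adm(1) obtain S' q' where S': "cofinite_sub S'" "H' = tau ` S'" "acts_as q' h' S'"
    by (rule admissibleE)
  with adm(2) have "q = q'" using adm_equiv_iff assms by blast
  then show "P \<in> pairs_acting_by q" using S' P unfolding pairs_acting_by_def by blast
next
  fix P assume "P \<in> pairs_acting_by q"
  then obtain h' S' where "P = (h', tau ` S')" "cofinite_sub S'" "acts_as q h' S'"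
    unfolding pairs_acting_by_def by blast
  then show "P \<in> adm_class M (h, tau ` S)"
    using adm_equiv_iff assms admissibleI unfolding adm_class_def by blast
qed

lemma exists_acting:
  assumes "q \<in> QF"
  obtains h S where "cofinite_sub S" "acts_as q h S"
proof -
  \<comment> \<open>The largest possible domain is taken, and the multiplication is conjugated by
    \<open>tau\<close>, which is invertible on \<open>RE3\<close>.\<close>
  let ?S = "{w \<in> L0. sm q w \<in> L0}" and ?h = "\<lambda>x. tau (sm q (inv_into RE3 tau x))"
  have "cv.fincodim ?S L0"
    using mults_fincodim_subset[OF _ subspace_R0 subspace_L0 L0_R0 L0_fincodim, of q]
      QF_subset_mults assms by (auto simp: mults_def)
  moreover have "cv.vs.subspace ?S" by (intro subspace_mult_vimage subspace_L0)
  ultimately have "cofinite_sub ?S"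
    using cofinite_subD(7)[OF cofinite_sub_L0]
    by (simp add: cofinite_sub_def bracket_subspace_def cross_sm_left[symmetric])
  moreover have "acts_as q ?h ?S"
    using L0_RE3 inj_on_tau by (simp add: acts_as_def subset_iff)
  ultimately show ?thesis by (rule that)
qed

lemma pairs_acting_byI: "cofinite_sub S \<Longrightarrow> acts_as q h S \<Longrightarrow> (h, tau ` S) \<in> pairs_acting_by q"
  unfolding pairs_acting_by_def by blast

lemma pairs_acting_by_nonempty:
  assumes "q \<in> QF"
  shows "pairs_acting_by q \<noteq> {}"
proof -
  obtain h S where "cofinite_sub S" "acts_as q h S" using exists_acting[OF assms] .
  then show ?thesis using pairs_acting_byI by blast
qed

lemma Icarrier_eq: "Icarrier M = pairs_acting_by ` QF"
proof
  show "Icarrier M \<subseteq> pairs_acting_by ` QF"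
  proof
    fix A assume "A \<in> Icarrier M"
    then obtain h H where A: "A = adm_class M (h, H)" "admissible M (h, H)"
      unfolding Icarrier_def by fastforce
    then show "A \<in> pairs_acting_by ` QF" by (metis admissibleE adm_class_eq imageI)
  qed
  show "pairs_acting_by ` QF \<subseteq> Icarrier M"
  proof
    fix A assume "A \<in> pairs_acting_by ` QF"
    then obtain q where q: "q \<in> QF" "A = pairs_acting_by q" by blast
    obtain h S where S: "cofinite_sub S" "acts_as q h S" using exists_acting[OF q(1)] .
    then have "A = adm_class M (h, tau ` S)" using q(2) adm_class_eq by simp
    then show "A \<in> Icarrier M" unfolding Icarrier_def using admissibleI[OF S] by blast
  qed
qed

lemma inj_on_pairs_acting_by: "inj_on pairs_acting_by QF"
proof (rule inj_onI)
  fix q r assume qr: "q \<in> QF" "pairs_acting_by q = pairs_acting_by r"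
  obtain h S where S: "cofinite_sub S" "acts_as q h S" using exists_acting[OF qr(1)] .
  then have "(h, tau ` S) \<in> pairs_acting_by r" using pairs_acting_byI qr(2) by blast
  then obtain S' where S': "tau ` S = tau ` S'" "cofinite_sub S'" "acts_as r h S'"
    unfolding pairs_acting_by_def by blast
  have "S = S'"
    using inj_on_image_eq_iff[OF inj_on_tau] S S' cofinite_subD(2) by simp
  then show "q = r" using acts_as_unique S S' by simp
qed

lemma pairs_acting_by_E:
  assumes "(h, H) \<in> pairs_acting_by q"
  obtains S where "H = tau ` S" "cofinite_sub S" "acts_as q h S" "S \<subseteq> RE3"
    "\<And>w. w \<in> S \<Longrightarrow> sm q w \<in> L0 \<and> sm q w \<in> RE3 \<and> h (tau w) = tau (sm q w)"
  using assms cofinite_subD(2) L0_RE3 unfolding pairs_acting_by_def acts_as_def by blast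

lemma tau_image_Int: "S \<subseteq> RE3 \<Longrightarrow> S' \<subseteq> RE3 \<Longrightarrow> tau ` S \<inter> tau ` S' = tau ` (S \<inter> S')"
  using inj_on_image_Int[OF inj_on_tau] by blast

lemma I_add_pairs_acting_by:
  assumes "q \<in> QF" "r \<in> QF"
  shows "I_add M (pairs_acting_by q) (pairs_acting_by r) = pairs_acting_by (q + r)"
  unfolding I_add_def
proof (intro UNION_const2 pairs_acting_by_nonempty assms)
  fix h1 H1 h2 H2 assume "(h1, H1) \<in> pairs_acting_by q" "(h2, H2) \<in> pairs_acting_by r"
  then obtain S1 S2 where
    1: "H1 = tau ` S1" "cofinite_sub S1" "S1 \<subseteq> RE3"
      "\<And>w. w \<in> S1 \<Longrightarrow> sm q w \<in> L0 \<and> sm q w \<in> RE3 \<and> h1 (tau w) = tau (sm q w)" and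
    2: "H2 = tau ` S2" "cofinite_sub S2" "S2 \<subseteq> RE3"
      "\<And>w. w \<in> S2 \<Longrightarrow> sm r w \<in> L0 \<and> sm r w \<in> RE3 \<and> h2 (tau w) = tau (sm r w)"
    by (metis pairs_acting_by_E)
  have "acts_as (q + r) (\<lambda>x. ladd M (h1 x) (h2 x)) (S1 \<inter> S2)"
    using 1 2 cofinite_subD(5)[OF cofinite_sub_L0]
    by (simp add: acts_as_def tau_add sm_add_left)
  then show "adm_class M (\<lambda>x. ladd M (h1 x) (h2 x), H1 \<inter> H2) = pairs_acting_by (q + r)"
    using 1 2 by (simp add: tau_image_Int adm_class_eq cofinite_sub_Int)
qed

lemma I_smul_pairs_acting_by:
  assumes "q \<in> QF"
  shows "I_smul M k (pairs_acting_by q) = pairs_acting_by (fls_const k * q)"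
  unfolding I_smul_def
proof (intro UNION_const1 pairs_acting_by_nonempty assms)
  fix h H assume "(h, H) \<in> pairs_acting_by q"
  then obtain S where
    1: "H = tau ` S" "cofinite_sub S" "S \<subseteq> RE3"
      "\<And>w. w \<in> S \<Longrightarrow> sm q w \<in> L0 \<and> sm q w \<in> RE3 \<and> h (tau w) = tau (sm q w)"
    by (metis pairs_acting_by_E)
  have "acts_as (fls_const k * q) (\<lambda>x. lsmul M k (h x)) S"
    using 1 cofinite_subD(6)[OF cofinite_sub_L0]
    by (simp add: acts_as_def tau_smul sm_sm[symmetric])
  then show "adm_class M (\<lambda>x. lsmul M k (h x), H) = pairs_acting_by (fls_const k * q)"
    using 1 by (simp add: adm_class_eq)
qed

lemma I_mul_pairs_acting_by:
  assumes "q \<in> QF" "r \<in> QF"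
  shows "I_mul M (pairs_acting_by q) (pairs_acting_by r) = pairs_acting_by (q * r)"
  unfolding I_mul_def
proof (intro UNION_const2 pairs_acting_by_nonempty assms)
  fix h1 H1 h2 H2 assume "(h1, H1) \<in> pairs_acting_by q" "(h2, H2) \<in> pairs_acting_by r"
  then obtain S1 S2 where
    1: "H1 = tau ` S1" "cofinite_sub S1" "S1 \<subseteq> RE3"
      "\<And>w. w \<in> S1 \<Longrightarrow> sm q w \<in> L0 \<and> sm q w \<in> RE3 \<and> h1 (tau w) = tau (sm q w)" and
    2: "H2 = tau ` S2" "cofinite_sub S2" "S2 \<subseteq> RE3"
      "\<And>w. w \<in> S2 \<Longrightarrow> sm r w \<in> L0 \<and> sm r w \<in> RE3 \<and> h2 (tau w) = tau (sm r w)"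
    by (metis pairs_acting_by_E)
  let ?S = "{w \<in> S1 \<inter> S2. sm r w \<in> S1}"
  have "cofinite_sub ?S"
    using 1 2 by (intro cofinite_sub_mult_vimage cofinite_sub_Int) auto
  moreover have "acts_as (q * r) (h1 \<circ> h2) ?S"
    using 1 2 unfolding acts_as_def by (simp add: sm_sm[symmetric])
  \<comment> \<open>The product is defined with a domain of cosets; injectivity of
    \<open>tau\<close> on \<open>RE3\<close> turns it into a condition on series.\<close>
  moreover have "{x \<in> H1 \<inter> H2. h2 x \<in> H1} = tau ` ?S"
  proof -
    have "H1 \<inter> H2 = tau ` (S1 \<inter> S2)" using 1 2 by (simp add: tau_image_Int)
    then have "{x \<in> H1 \<inter> H2. h2 x \<in> H1} = tau ` {w \<in> S1 \<inter> S2. h2 (tau w) \<in> H1}"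
      by (simp only: Compr_image_eq)
    moreover have "h2 (tau w) \<in> H1 \<longleftrightarrow> sm r w \<in> S1" if "w \<in> S1 \<inter> S2" for w
      using 1 2 that by (simp add: tau_in_image_iff)
    ultimately show ?thesis by (simp cong: conj_cong)
  qed
  ultimately show "adm_class M (h1 \<circ> h2, {x \<in> H1 \<inter> H2. h2 x \<in> H1}) = pairs_acting_by (q * r)"
    by (simp add: adm_class_eq)
qed

lemma I_isomorphic_Q:
  "\<exists>\<phi>. bij_betw \<phi> (Icarrier M) (Qcarrier e1 e2 e3)
     \<and> (\<forall>A\<in>Icarrier M. \<forall>B\<in>Icarrier M. \<phi> (I_add M A B) = Q_add e1 e2 e3 (\<phi> A) (\<phi> B)
          \<and> \<phi> (I_mul M A B) = Q_mul e1 e2 e3 (\<phi> A) (\<phi> B))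
     \<and> (\<forall>c. \<forall>A\<in>Icarrier M. \<phi> (I_smul M c A) = Q_smul e1 e2 e3 c (\<phi> A))"
proof -
  \<comment> \<open>Both algebras are indexed by \<open>QF\<close> compatibly with the operations;
    the isomorphism passes through the common index.\<close>
  define \<phi> where "\<phi> = fracs_of \<circ> inv_into QF pairs_acting_by"
  have \<phi>: "\<phi> (pairs_acting_by q) = fracs_of q" if "q \<in> QF" for q
    using that inj_on_pairs_acting_by by (simp add: \<phi>_def)
  have "bij_betw \<phi> (Icarrier M) (Qcarrier e1 e2 e3)"
    unfolding \<phi>_def Icarrier_eq Qcarrier_eq
    by (intro bij_betw_trans[of _ _ QF] bij_betw_inv_into) (simp_all add: bij_betw_def inj_on_pairs_acting_by inj_on_fracs_of)
  moreover have "fls_const c * q \<in> QF" if "q \<in> QF" for c q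
    using that QF_mult QF_ez[of "[:c:]"] by simp
  ultimately show ?thesis
    by (intro exI[of _ \<phi>]) (simp add: Icarrier_eq I_add_pairs_acting_by I_mul_pairs_acting_by I_smul_pairs_acting_by \<phi>
        QF_add QF_mult Q_add_fracs_of Q_mul_fracs_of Q_smul_fracs_of)
qed

lemma I_commutative:
  "A \<in> Icarrier M \<Longrightarrow> B \<in> Icarrier M \<Longrightarrow> I_mul M A B = I_mul M B A"
  by (auto simp: Icarrier_eq I_mul_pairs_acting_by mult.commute)

end

text \<open>A power series over the complex numbers with nonzero constant term has a square root,
  built from a square root of that constant term.\<close>

lemma fls_sqrt_exists:
  fixes c :: complex
  assumes "c \<noteq> 0"
  obtains s :: "complex fls" where "s ^ 2 = fls_X ^ 2 + fls_const c"
proof -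
  let ?a = "fps_X ^ 2 + fps_const c :: complex fps"
  have "csqrt c * csqrt c = c" by (metis power2_csqrt power2_eq_square)
  \<comment> \<open>\<open>power_radical\<close> is applied in its form for exponents
    \<open>Suc k\<close>, so the square root is the case \<open>k = 1\<close>.\<close>
  then have "fps_radical (\<lambda>_. csqrt) (Suc 1) ?a ^ Suc 1 = ?a"
    using assms by (intro power_radical[THEN iffD1]) (simp_all add: power2_eq_square)
  then have "fps_radical (\<lambda>_. csqrt) 2 ?a ^ 2 = ?a" by (simp add: numeral_2_eq_2)
  then have "fps_to_fls (fps_radical (\<lambda>_. csqrt) 2 ?a) ^ 2 = fps_to_fls ?a"
    by (simp flip: fps_to_fls_power)
  then show ?thesis by (intro that) (simp add: fps_to_fls_power)
qed

theorem theorem6p8: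
  fixes e1 e2 e3 :: complex and L :: "tens set"
  assumes "e1 \<noteq> e2" "e1 \<noteq> e3" "e2 \<noteq> e3"
    and "lie_subalg (Rlie e1 e2 e3) L" and "fin_codim (Rlie e1 e2 e3) L"
  shows "(\<forall>A\<in>Icarrier ((Rlie e1 e2 e3)\<lparr>lcarrier := L\<rparr>). \<forall>B\<in>Icarrier ((Rlie e1 e2 e3)\<lparr>lcarrier := L\<rparr>).
            I_mul ((Rlie e1 e2 e3)\<lparr>lcarrier := L\<rparr>) A B = I_mul ((Rlie e1 e2 e3)\<lparr>lcarrier := L\<rparr>) B A)
       \<and> (\<exists>\<phi>. bij_betw \<phi> (Icarrier ((Rlie e1 e2 e3)\<lparr>lcarrier := L\<rparr>)) (Qcarrier e1 e2 e3)
           \<and> (\<forall>A\<in>Icarrier ((Rlie e1 e2 e3)\<lparr>lcarrier := L\<rparr>). \<forall>B\<in>Icarrier ((Rlie e1 e2 e3)\<lparr>lcarrier := L\<rparr>).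
                \<phi> (I_add ((Rlie e1 e2 e3)\<lparr>lcarrier := L\<rparr>) A B) = Q_add e1 e2 e3 (\<phi> A) (\<phi> B)
              \<and> \<phi> (I_mul ((Rlie e1 e2 e3)\<lparr>lcarrier := L\<rparr>) A B) = Q_mul e1 e2 e3 (\<phi> A) (\<phi> B))
           \<and> (\<forall>c. \<forall>A\<in>Icarrier ((Rlie e1 e2 e3)\<lparr>lcarrier := L\<rparr>).
                \<phi> (I_smul ((Rlie e1 e2 e3)\<lparr>lcarrier := L\<rparr>) c A) = Q_smul e1 e2 e3 c (\<phi> A)))"
proof -
  obtain v2 v3 :: "complex fls" where
    "v2 ^ 2 = fls_X ^ 2 + fls_const (e1 - e2)" "v3 ^ 2 = fls_X ^ 2 + fls_const (e1 - e3)"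
    using fls_sqrt_exists assms(1,2) by (metis right_minus_eq)
  then interpret curve_series e1 e2 e3 v2 v3
    using assms(1-3) by unfold_locales
  have "L \<subseteq> tau ` R0" using assms(4) by (simp add: lie_subalg_def Rlie_eq)
  \<comment> \<open>L is pulled back to a set of triples of series, where the hypotheses on it
    become the assumptions of \<open>curve_subalgebra\<close>.\<close>
  then obtain L0 where L0: "L0 \<subseteq> R0" "L = tau ` L0" by (auto elim: subset_imageE)
  then have "L0 \<subseteq> RE3" using R0_subset_RE3 by blast
  then have "bracket_subspace L0" "cv.fincodim L0 R0"
    using assms(4,5) L0 R0_subset_RE3 by (simp_all add: Rlie_eq lie_subalg_tau fin_codim_tau)
  with L0 interpret curve_subalgebra e1 e2 e3 v2 v3 L0
    by unfold_locales
  have "(Rlie e1 e2 e3)\<lparr>lcarrier := L\<rparr> = M"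
    by (simp add: lie_on_def L0)
  then show ?thesis using I_commutative I_isomorphic_Q by simp
qed

end
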